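(* Let $\chi$ be a Dirichlet character modulo $N$, $k\in\mathbb{Z}$, $\kappa=2k+e(\chi)\ge1$, $d\in\mathbb{N}$ and $\omega\in\{\bullet,\star\}$. Define \[ C^{\omega}_{d}(\kappa,\chi)= \begin{cases} \dfrac{\varepsilon^{d}_{\omega}(-1)^{k(d-\tilde{\varepsilon}_{\omega})}}{((2d+1-\tilde{\varepsilon}_{\omega})k)!} & (N=1,\ \kappa=2k),\\[2mm] \dfrac{\varepsilon^d_{\omega}(-1)^{kd}}{2^{2kd}(2kd)!} & (N=2,\ \kappa=2k),\\[2mm] \dfrac{\varepsilon^d_{\omega}(-1)^{\kappa d}}{(N^{2d-\varepsilon_{\omega}}2^{(N-1)\varepsilon_{\omega}})^{\frac{\kappa}{2}}(\kappa d)!} & (N\ge 3). \end{cases} \] Then $A^{\omega}_{n}(\kappa,\chi)=0$ whenever $\kappa\nmid n$, and \[ L^{\omega}_d\bigl(\{\kappa\}^d;\{\chi\}^d\bigr) =C^{\omega}_{d}(\kappa,\chi)\,A^{\omega}_{\kappa d}(\kappa,\chi)\,\pi^{\kappa d}. \]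
   Context: $L^{\omega}_d(s_1,\ldots,s_d;f_1,\ldots,f_d):=\sum_{(m_1,\ldots,m_d)\in I^{\omega}_d}\prod_{j=1}^d f_j(m_j)m_j^{-s_j}$, with $I^{\bullet}_d=\{(m_j)\in\mathbb{N}^d: m_1<\cdots<m_d\}$, $I^{\star}_d=\{(m_j)\in\mathbb{N}^d: m_1\le\cdots\le m_d\}$; $\{x\}^d$ is $x$ repeated $d$ times. $e(\chi)\in\{0,1\}$ with $\chi(-1)=(-1)^{e(\chi)}$. $\varepsilon_\bullet=-1$, $\varepsilon_\star=1$, $\tilde\varepsilon_\omega=\frac{\varepsilon_\omega+1}{2}$. $\zeta_m=e^{2\pi i/m}$, $\bar N=\lfloor\frac{N-1}{2}\rfloor$. $B_n$ Bernoulli numbers, $E_n$ Euler numbers ($\sec t=\sum_n(-1)^nE_{2n}t^{2n}/(2n)!$). For $a\notin\pi\mathbb{Z}$, $T^{\omega}_n(a)$ is defined by $\sin(a+t)=\sum_{n\ge0}T^{\bullet}_n(a)\frac{t^n}{n!}$ and $\mathrm{cosec}(a+t)=\sum_{n\ge0}T^{\star}_n(a)\frac{t^n}{n!}$. The numbers $A^{\omega}_n(\kappa,\chi)$ ($n\ge0$) are defined as follows. (i) $N=1$ ($\chi=\mathbf 1$, $\kappa=2k$): $A^{\omega}_{2n+1}(2k,\mathbf 1)=0$, $A^{\bullet}_{2n}(2k,\mathbf 1)=\sum_{n_1+\cdots+n_k=n,\ n_l\ge0}\binom{2n+k}{2n_1+1,\ldots,2n_k+1}\zeta_k^{\sum_l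 ln_l}$, $A^{\star}_{2n}(2k,\mathbf 1)=\sum_{n_1+\cdots+n_k=n}\binom{2n}{2n_1,\ldots,2n_k}\bigl(\prod_{l=1}^k(2^{2n_l}-2)B_{2n_l}\bigr)\zeta_k^{\sum_l ln_l}$. (ii) $N=2$ ($\chi=\chi^{(2)}_1$ the principal character mod 2, $\kappa=2k$): $A^{\omega}_{2n+1}=0$, $A^{\bullet}_{2n}(2k,\chi^{(2)}_1)=\sum_{n_1+\cdots+n_k=n}\binom{2n}{2n_1,\ldots,2n_k}\zeta_k^{\sum_l ln_l}$, $A^{\star}_{2n}(2k,\chi^{(2)}_1)=\sum_{n_1+\cdots+n_k=n}\binom{2n}{2n_1,\ldots,2n_k}\bigl(\prod_l E_{2n_l}\bigr)\zeta_k^{\sum_l ln_l}$. (iii) $N\ge3$: for $1\le j\le\bar N$, $A^{\omega}_n(j;\kappa,\chi)=\sum_{n_1+\cdots+n_\kappa=n,\ n_l\ge0}\binom{n}{n_1,\ldots,n_\kappa}\bigl(\prod_{l=1}^\kappa T^{\omega}_{n_l}(\tfrac{\pi j}{N})\bigr)\zeta_\kappa^{\sum_l ln_l}$, and $A^{\omega}_n(\kappa,\chi)=\sum_{n_1+\cdots+n_{\bar N}=n}\binom{n}{n_1,\ldots,n_{\bar N}}\prod_{j=1}^{\bar N}A^{\omega}_{n_j}(j;\kappa,\chi)\,\chi(j)^{n_j/\kappa}$, where $\chi(j)^{n_j/\kappa}=(\chi(j)^{1/\kappa})^{n_j}$ with $\chi(j)^{1/\kappa}$ computed using $0\le\arg\chi(j)<2\pi$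 (and $=0$ if $\chi(j)=0$, with $0^0=1$). Multinomial coefficients $\binom{n}{a,b,\ldots}$ have $n=a+b+\cdots$. *)

theory Defs
  imports "HOL-Complex_Analysis.Complex_Analysis"
begin

definition dirichlet_character :: "nat \<Rightarrow> (int \<Rightarrow> complex) \<Rightarrow> bool" where
  "dirichlet_character N chi \<longleftrightarrow>
     N \<ge> 1 \<and> chi 1 = 1 \<and>
     (\<forall>a b. chi (a * b) = chi a * chi b) \<and>
     (\<forall>a. chi (a + int N) = chi a) \<and>
     (\<forall>a. chi a = 0 \<longleftrightarrow> \<not> coprime a (int N))"

datatype mode = Bullet | Star

fun eps :: "mode \<Rightarrow> int" where
  "eps Bullet = -1"
| "eps Star = 1"

(* The quotient is exact: the value is 0 or 1. *)
definition eps_tilde :: "mode \<Rightarrow> int" where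
  "eps_tilde \<omega> = (eps \<omega> + 1) div 2"

definition zeta_root :: "nat \<Rightarrow> complex" where
  "zeta_root m = exp (2 * of_real pi * \<i> / of_nat m)"

subsection \<open>Multiple L-values\<close>

(* A tuple (m_1, ..., m_d) of positive integers is a list of length d. *)
definition index_set :: "mode \<Rightarrow> nat \<Rightarrow> nat list set" where
  "index_set \<omega> d = {ms. length ms = d \<and> (\<forall>m\<in>set ms. m \<ge> 1) \<and>
     (case \<omega> of Bullet \<Rightarrow> sorted_wrt (<) ms | Star \<Rightarrow> sorted_wrt (\<le>) ms)}"

definition mult_L_term :: "complex list \<Rightarrow> (nat \<Rightarrow> complex) list \<Rightarrow> nat list \<Rightarrow> complex" where
  "mult_L_term ss fs ms =
     (\<Prod>j<length ss. (fs ! j) (ms ! j) * of_nat (ms ! j) powr (- (ss ! j)))"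

definition mult_L_partial ::
    "mode \<Rightarrow> complex list \<Rightarrow> (nat \<Rightarrow> complex) list \<Rightarrow> nat \<Rightarrow> complex" where
  "mult_L_partial \<omega> ss fs M =
     (\<Sum>ms\<in>{ms \<in> index_set \<omega> (length ss). \<forall>m\<in>set ms. m \<le> M}. mult_L_term ss fs ms)"

(* The series need not converge absolutely (for instance when all s_j = 1), so it is summed
   in the order of the largest index m_d. *)
definition mult_L :: "mode \<Rightarrow> complex list \<Rightarrow> (nat \<Rightarrow> complex) list \<Rightarrow> complex" where
  "mult_L \<omega> ss fs = lim (mult_L_partial \<omega> ss fs)"

(* When the series converges unconditionally, the value is the unordered sum. *)
lemma mult_L_eq_infsum:
  assumes "mult_L_term ss fs summable_on index_set \<omega> (length ss)"
  shows "convergent (mult_L_partial \<omega> ss fs)"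
    and "mult_L \<omega> ss fs = infsum (mult_L_term ss fs) (index_set \<omega> (length ss))"
proof -
  let ?I = "index_set \<omega> (length ss)"
  let ?J = "\<lambda>M. {ms \<in> ?I. \<forall>m\<in>set ms. m \<le> M}"
  have fin: "finite (?J M)" for M
  proof (rule finite_subset)
    show "?J M \<subseteq> {ms. set ms \<subseteq> {..M} \<and> length ms = length ss}"
      by (auto simp: index_set_def)
    show "finite {ms. set ms \<subseteq> {..M} \<and> length ms = length ss}"
      by (rule finite_lists_length_eq) simp
  qed
  have "filterlim ?J (finite_subsets_at_top ?I) sequentially"
    unfolding filterlim_finite_subsets_at_top
  proof (intro allI impI, elim conjE)
    fix X assume X: "finite X" "X \<subseteq> ?I"
    then have "finite (\<Union>ms\<in>X. set ms)" by auto
    then obtain B where B: "\<forall>m\<in>(\<Union>ms\<in>X. set ms). m \<le> B"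
      using finite_nat_set_iff_bounded_le by blast
    show "\<forall>\<^sub>F M in sequentially. finite (?J M) \<and> X \<subseteq> ?J M \<and> ?J M \<subseteq> ?I"
      using eventually_ge_at_top[of B]
    proof eventually_elim
      case (elim M)
      have "X \<subseteq> ?J M"
        using X(2) B elim by (fastforce intro: order_trans)
      then show ?case using fin by auto
    qed
  qed
  moreover have "(sum (mult_L_term ss fs) \<longlongrightarrow> infsum (mult_L_term ss fs) ?I)
      (finite_subsets_at_top ?I)"
    using has_sum_infsum[OF assms] by (simp add: has_sum_def)
  ultimately have "mult_L_partial \<omega> ss fs \<longlonglongrightarrow> infsum (mult_L_term ss fs) ?I"
    unfolding mult_L_partial_def by (rule filterlim_compose[rotated])
  then show "convergent (mult_L_partial \<omega> ss fs)"
    and "mult_L \<omega> ss fs = infsum (mult_L_term ss fs) ?I"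
    unfolding mult_L_def by (auto simp: convergent_def limI)
qed

subsection \<open>Bernoulli numbers, Euler numbers and the coefficients of sine and cosecant\<close>

(* t / (exp t - 1) = sum B_n t^n / n! *)
definition bernoulli_num :: "nat \<Rightarrow> complex" where
  "bernoulli_num n = fact n * fps_nth (fps_X / (fps_exp 1 - 1)) n"

(* sec t = sum (-1)^n E_(2n) t^(2n) / (2n)!, and E_n = 0 for odd n *)
definition euler_num :: "nat \<Rightarrow> complex" where
  "euler_num n = (if even n then (-1) ^ (n div 2) * fact n * fps_nth (inverse (fps_cos 1)) n else 0)"

fun trig_fun :: "mode \<Rightarrow> complex \<Rightarrow> complex" where
  "trig_fun Bullet z = sin z"
| "trig_fun Star z = 1 / sin z"

definition T_num :: "mode \<Rightarrow> complex \<Rightarrow> nat \<Rightarrow> complex" where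
  "T_num \<omega> a n = fact n * fps_nth (fps_expansion (\<lambda>t. trig_fun \<omega> (a + t)) 0) n"

lemma T_num_has_fps_expansion:
  assumes "\<And>k::int. a \<noteq> of_int k * of_real pi"
  shows "(\<lambda>t. trig_fun \<omega> (a + t)) has_fps_expansion Abs_fps (\<lambda>n. T_num \<omega> a n / fact n)"
proof -
  have "sin a \<noteq> 0"
    using assms by (auto simp: sin_eq_0)
  then have "(\<lambda>t. trig_fun \<omega> (a + t)) analytic_on {0}"
    by (cases \<omega>) (auto intro!: analytic_intros)
  then have "(\<lambda>t. trig_fun \<omega> (a + t)) has_fps_expansion fps_expansion (\<lambda>t. trig_fun \<omega> (a + t)) 0"
    by (rule analytic_at_imp_has_fps_expansion_0)
  then show ?thesis
    by (simp add: T_num_def fps_nth_inverse)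
qed

subsection \<open>The numbers $A$ and $C$\<close>

(* Tuples (n_1, ..., n_k) of natural numbers with sum n. *)
definition weak_comps :: "nat \<Rightarrow> nat \<Rightarrow> (nat \<Rightarrow> nat) set" where
  "weak_comps k n = {ns \<in> {1..k} \<rightarrow>\<^sub>E UNIV. (\<Sum>l=1..k. ns l) = n}"

(* The multinomial coefficient with lower entries ns 1, ..., ns k; its upper entry is their sum. *)
definition multinom :: "nat \<Rightarrow> (nat \<Rightarrow> nat) \<Rightarrow> complex" where
  "multinom k ns = fact (\<Sum>l=1..k. ns l) / (\<Prod>l=1..k. fact (ns l))"

definition A_num_1 :: "mode \<Rightarrow> nat \<Rightarrow> nat \<Rightarrow> complex" where
  "A_num_1 \<omega> k n = (\<Sum>ns\<in>weak_comps k n.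
     (case \<omega> of
        Bullet \<Rightarrow> multinom k (\<lambda>l. 2 * ns l + 1)
      | Star \<Rightarrow> multinom k (\<lambda>l. 2 * ns l) *
                (\<Prod>l=1..k. (2 ^ (2 * ns l) - 2) * bernoulli_num (2 * ns l)))
     * zeta_root k ^ (\<Sum>l=1..k. l * ns l))"

definition A_num_2 :: "mode \<Rightarrow> nat \<Rightarrow> nat \<Rightarrow> complex" where
  "A_num_2 \<omega> k n = (\<Sum>ns\<in>weak_comps k n.
     multinom k (\<lambda>l. 2 * ns l) *
     (case \<omega> of Bullet \<Rightarrow> 1 | Star \<Rightarrow> (\<Prod>l=1..k. euler_num (2 * ns l)))
     * zeta_root k ^ (\<Sum>l=1..k. l * ns l))"

definition A_num_j :: "mode \<Rightarrow> nat \<Rightarrow> nat \<Rightarrow> nat \<Rightarrow> nat \<Rightarrow> complex" where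
  "A_num_j \<omega> N j \<kappa> n = (\<Sum>ns\<in>weak_comps \<kappa> n.
     multinom \<kappa> ns *
     (\<Prod>l=1..\<kappa>. T_num \<omega> (of_real (pi * real j / real N)) (ns l))
     * zeta_root \<kappa> ^ (\<Sum>l=1..\<kappa>. l * ns l))"

(* The root z^(1/k) with argument of z in [0, 2*pi); it is 0 for z = 0. *)
definition princ_root :: "nat \<Rightarrow> complex \<Rightarrow> complex" where
  "princ_root k z = of_real (root k (norm z)) * cis (Arg2pi z / real k)"

definition A_num_ge3 :: "mode \<Rightarrow> nat \<Rightarrow> nat \<Rightarrow> (int \<Rightarrow> complex) \<Rightarrow> nat \<Rightarrow> complex" where
  "A_num_ge3 \<omega> N \<kappa> chi n = (\<Sum>ns\<in>weak_comps ((N - 1) div 2) n.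
     multinom ((N - 1) div 2) ns *
     (\<Prod>j=1..(N - 1) div 2. A_num_j \<omega> N j \<kappa> (ns j) * princ_root \<kappa> (chi (int j)) ^ ns j))"

(* A Dirichlet character modulo 1 or 2 is principal and even, so kappa = 2 k in these cases. *)
definition A_num :: "mode \<Rightarrow> nat \<Rightarrow> nat \<Rightarrow> (int \<Rightarrow> complex) \<Rightarrow> nat \<Rightarrow> complex" where
  "A_num \<omega> N \<kappa> chi n =
     (if N = 1 then (if odd n then 0 else A_num_1 \<omega> (\<kappa> div 2) (n div 2))
      else if N = 2 then (if odd n then 0 else A_num_2 \<omega> (\<kappa> div 2) (n div 2))
      else A_num_ge3 \<omega> N \<kappa> chi n)"

definition C_num :: "mode \<Rightarrow> nat \<Rightarrow> nat \<Rightarrow> nat \<Rightarrow> real" where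
  "C_num \<omega> N d \<kappa> =
     (if N = 1 then
        (let k = int (\<kappa> div 2) in
          of_int (eps \<omega> ^ d) * (-1) powi (k * (int d - eps_tilde \<omega>))
            / fact (nat ((2 * int d + 1 - eps_tilde \<omega>) * k)))
      else if N = 2 then
        (let k = \<kappa> div 2 in
          of_int (eps \<omega> ^ d) * (-1) ^ (k * d) / (2 ^ (2 * k * d) * fact (2 * k * d)))
      else
        of_int (eps \<omega> ^ d) * (-1) ^ (\<kappa> * d)
          / ((real N powi (2 * int d - eps \<omega>) * 2 powi ((int N - 1) * eps \<omega>)) powr (real \<kappa> / 2)
             * fact (\<kappa> * d)))"

end

theory Submission
  imports Defs
begin

text \<open>
  Let \<open>P(t) = \<Prod>\<^sub>m (1 - \<chi>(m) t\<^sup>\<kappa> / m\<^sup>\<kappa>)\<close>. The multiple L-values are, up to the sign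
  \<open>\<epsilon>\<^sup>d\<close>, the coefficients of \<open>P\<close> (elementary symmetric functions, bullet) and of \<open>1 / P\<close>
  (complete homogeneous symmetric functions, star). Each factor splits as
  \<open>\<Prod>\<^sub>l (1 - \<zeta>\<^sub>\<kappa>\<^sup>l \<chi>(m)\<^bsup>1/\<kappa>\<^esup> t / m)\<close>, and collecting the \<open>m\<close> that are congruent
  to \<open>j\<close> or \<open>-j\<close> modulo \<open>N\<close> (legitimate because \<open>\<chi>(-1) = (-1)\<^sup>\<kappa>\<close>) turns \<open>P\<close> into a finite product
  of quotients \<open>sin (\<pi> j / N - u) / sin (\<pi> j / N)\<close>; for \<open>N = 1, 2\<close> it is a product of values of
  \<open>sin u / u\<close> and \<open>cos u\<close>. Expanding this product gives the numbers \<open>A\<close>. All limits are limits of the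
  coefficients of formal power series, so the conditionally convergent case \<open>\<kappa> = 1\<close> needs no special
  treatment: the convergence of the partial products is only needed along the arithmetic progression of
  lengths for which the blocks \<open>\<plusminus>j\<close> are complete.
\<close>

unbundle no vec_syntax

section \<open>Coefficientwise limits of formal power series\<close>

text \<open>Weaker than convergence in the \<open>X\<close>-adic metric on \<open>fps\<close>, where
  each coefficient has to become constant.\<close>

definition fps_lim :: "(nat \<Rightarrow> complex fps) \<Rightarrow> complex fps \<Rightarrow> bool" where
  "fps_lim F G \<longleftrightarrow> (\<forall>n. (\<lambda>M. F M $ n) \<longlonglongrightarrow> G $ n)"

lemma fps_lim_const [simp]: "fps_lim (\<lambda>_. F) F"
  by (simp add: fps_lim_def)

lemma fps_lim_fps_const: "c \<longlonglongrightarrow> L \<Longrightarrow> fps_lim (\<lambda>M. fps_const (c M)) (fps_const L)"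
  by (simp add: fps_lim_def)

lemma fps_lim_diff:
  assumes "fps_lim F G" "fps_lim F' G'"
  shows "fps_lim (\<lambda>M. F M - F' M) (G - G')"
  using assms unfolding fps_lim_def by (auto intro!: tendsto_intros)

lemma fps_lim_mult:
  assumes "fps_lim F G" "fps_lim F' G'"
  shows "fps_lim (\<lambda>M. F M * F' M) (G * G')"
  using assms unfolding fps_lim_def fps_mult_nth by (auto intro!: tendsto_intros)

lemma fps_lim_prod:
  assumes "\<And>i. i \<in> I \<Longrightarrow> fps_lim (F i) (G i)"
  shows "fps_lim (\<lambda>M. \<Prod>i\<in>I. F i M) (\<Prod>i\<in>I. G i)"
  using assms by (induction I rule: infinite_finite_induct) (auto intro: fps_lim_mult)

lemma prod_fps_const: "(\<Prod>i\<in>I. fps_const (f i)) = fps_const (\<Prod>i\<in>I. f i :: 'a :: comm_ring_1)"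
  by (induction I rule: infinite_finite_induct) auto

text \<open>For \<open>f $ 0 \<noteq> 0\<close> this solves \<open>f * inverse f = 1\<close> for the
  top coefficient; for \<open>f $ 0 = 0\<close> both sides are 0 by the conventions for
  \<open>inverse\<close>. Holding for all \<open>f\<close>, it can be applied inside a
  limit.\<close>

lemma fps_inverse_nth_rec:
  fixes f :: "'a :: field fps"
  shows "inverse f $ n = (if n = 0 then inverse (f $ 0)
           else - inverse (f $ 0) * (\<Sum>i=1..n. f $ i * inverse f $ (n - i)))"
proof (cases "f $ 0 = 0 \<or> n = 0")
  case True
  then consider "n = 0" | "f $ 0 = 0" by blast
  then show ?thesis
  proof cases
    case 2
    then have "inverse f = 0" by simp
    with 2 show ?thesis by (simp only: fps_zero_nth) simp
  qed auto
next
  case False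
  then have "f * inverse f = 1" by (intro inverse_mult_eq_1') auto
  then have "(\<Sum>i=0..n. f $ i * inverse f $ (n - i)) = 0"
    using False by (simp flip: fps_mult_nth)
  then have "f $ 0 * inverse f $ n + (\<Sum>i=1..n. f $ i * inverse f $ (n - i)) = 0"
    using False by (simp add: sum.atLeast_Suc_atMost)
  then show ?thesis using False
    by (simp add: field_simps eq_neg_iff_add_eq_0)
qed

text \<open>The recursion expresses each coefficient of the inverse continuously through earlier
  ones, so strong induction on the coefficient index suffices.\<close>

lemma fps_lim_inverse:
  assumes "fps_lim F G" "G $ 0 \<noteq> 0"
  shows "fps_lim (\<lambda>M. inverse (F M)) (inverse G)"
  unfolding fps_lim_def
proof
  fix n
  have F: "(\<lambda>M. F M $ n) \<longlonglongrightarrow> G $ n" for n using assms by (simp add: fps_lim_def)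
  show "(\<lambda>M. inverse (F M) $ n) \<longlonglongrightarrow> inverse G $ n"
  proof (induction n rule: less_induct)
    case (less n)
    have "(\<lambda>M. if n = 0 then inverse (F M $ 0)
             else - inverse (F M $ 0) * (\<Sum>i=1..n. F M $ i * inverse (F M) $ (n - i)))
       \<longlonglongrightarrow> (if n = 0 then inverse (G $ 0)
             else - inverse (G $ 0) * (\<Sum>i=1..n. G $ i * inverse G $ (n - i)))"
      using assms(2) by (cases "n = 0") (auto intro!: tendsto_intros F less)
    then show ?case by (subst (1 2) fps_inverse_nth_rec)
  qed
qed

lemma fps_lim_compose_linear:
  assumes "fps_lim F G"
  shows "fps_lim (\<lambda>M. F M oo (fps_const c * fps_X)) (G oo (fps_const c * fps_X))"
  using assms by (auto simp: fps_lim_def fps_compose_linear intro!: tendsto_intros)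

text \<open>Composition only spreads the coefficients out to the multiples of \<open>p\<close>. This
  moves limits between the variables \<open>t\<close> and \<open>t^p\<close>.\<close>

lemma fps_lim_compose_power_iff:
  assumes "p \<ge> 1"
  shows "fps_lim (\<lambda>M. F M oo fps_X ^ p) (G oo fps_X ^ p) \<longleftrightarrow> fps_lim F G"
proof
  assume L: "fps_lim (\<lambda>M. F M oo fps_X ^ p) (G oo fps_X ^ p)"
  show "fps_lim F G" unfolding fps_lim_def
  proof
    fix n
    show "(\<lambda>M. F M $ n) \<longlonglongrightarrow> G $ n"
      using L[unfolded fps_lim_def, rule_format, of "p * n"] assms
      by (simp add: fps_nth_compose_X_power)
  qed
qed (auto simp: fps_lim_def fps_nth_compose_X_power)

section \<open>Generating functions of the truncated sums\<close>

definition bounded_index_set :: "mode \<Rightarrow> nat \<Rightarrow> nat \<Rightarrow> nat list set" where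
  "bounded_index_set \<omega> d M = {ms \<in> index_set \<omega> d. \<forall>m\<in>set ms. m \<le> M}"

text \<open>The elementary symmetric (\<open>Bullet\<close>) or complete homogeneous
  (\<open>Star\<close>) polynomial of degree \<open>d\<close> in
  \<open>a 1, ..., a M\<close>.\<close>

definition mult_sum :: "mode \<Rightarrow> (nat \<Rightarrow> complex) \<Rightarrow> nat \<Rightarrow> nat \<Rightarrow> complex" where
  "mult_sum \<omega> a d M = (\<Sum>ms\<in>bounded_index_set \<omega> d M. prod_list (map a ms))"

lemma finite_bounded_index_set: "finite (bounded_index_set \<omega> d M)"
proof (rule finite_subset)
  show "bounded_index_set \<omega> d M \<subseteq> {ms. set ms \<subseteq> {..M} \<and> length ms = d}"
    by (auto simp: bounded_index_set_def index_set_def)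
qed (auto intro: finite_lists_length_eq)

lemma mult_sum_0 [simp]: "mult_sum \<omega> a 0 M = 1"
proof -
  have "bounded_index_set \<omega> 0 M = {[]}"
    by (cases \<omega>) (auto simp: bounded_index_set_def index_set_def)
  then show ?thesis by (simp add: mult_sum_def)
qed

lemma mult_sum_Suc_0 [simp]: "mult_sum \<omega> a (Suc d) 0 = 0"
proof -
  have "bounded_index_set \<omega> (Suc d) 0 = {}"
    by (cases \<omega>) (fastforce simp: bounded_index_set_def index_set_def length_Suc_conv)+
  then show ?thesis by (simp add: mult_sum_def)
qed

text \<open>Tuples are split by whether their last entry is \<open>Suc M\<close>. The other entries
  then stay below it for \<open>Bullet\<close> but may equal it for \<open>Star\<close>.\<close>

lemma bounded_index_set_Suc:
  "bounded_index_set \<omega> (Suc d) (Suc M) = bounded_index_set \<omega> (Suc d) M \<union>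
     (\<lambda>ms. ms @ [Suc M]) ` bounded_index_set \<omega> d (case \<omega> of Bullet \<Rightarrow> M | Star \<Rightarrow> Suc M)"
  (is "?A = ?B \<union> ?C")
proof (rule set_eqI)
  fix ms :: "nat list"
  show "ms \<in> ?A \<longleftrightarrow> ms \<in> ?B \<union> ?C"
  proof (cases ms rule: rev_cases)
    case Nil
    then show ?thesis by (auto simp: bounded_index_set_def index_set_def)
  next
    case (snoc ns x)
    show ?thesis
      by (cases \<omega>) (fastforce simp: snoc bounded_index_set_def index_set_def sorted_wrt_append 
          le_Suc_eq image_iff less_Suc_eq_le)+
  qed
qed

lemma mult_sum_Suc_Suc:
  "mult_sum \<omega> a (Suc d) (Suc M) = mult_sum \<omega> a (Suc d) M +
     a (Suc M) * mult_sum \<omega> a d (case \<omega> of Bullet \<Rightarrow> M | Star \<Rightarrow> Suc M)"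
  unfolding mult_sum_def bounded_index_set_Suc
  by (subst sum.union_disjoint)
     (auto simp: finite_bounded_index_set sum.reindex inj_on_def sum_distrib_left mult_ac,
      auto simp: bounded_index_set_def)

text \<open>\<open>mode_inv \<omega> F\<close> is \<open>F\<close> raised to the power \<open>- eps \<omega>\<close>.\<close>
definition mode_inv :: "mode \<Rightarrow> complex fps \<Rightarrow> complex fps" where
  "mode_inv \<omega> F = (case \<omega> of Bullet \<Rightarrow> F | Star \<Rightarrow> inverse F)"

lemma mode_inv_1 [simp]: "mode_inv \<omega> 1 = 1"
  by (cases \<omega>) (auto simp: mode_inv_def)

lemma mode_inv_mult: "mode_inv \<omega> (F * G) = mode_inv \<omega> F * mode_inv \<omega> G"
  by (cases \<omega>) (auto simp: mode_inv_def fps_inverse_mult)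

lemma mode_inv_prod: "mode_inv \<omega> (\<Prod>i\<in>I. F i) = (\<Prod>i\<in>I. mode_inv \<omega> (F i))"
  by (cases \<omega>) (auto simp: mode_inv_def inverse_prod_fps)

lemma mode_inv_compose:
  assumes "F $ 0 \<noteq> 0" "G $ 0 = 0"
  shows "mode_inv \<omega> (F oo G) = mode_inv \<omega> F oo G"
  using assms by (cases \<omega>) (auto simp: mode_inv_def fps_inverse_compose)

lemma fps_lim_mode_inv:
  assumes "fps_lim F G" "G $ 0 \<noteq> 0"
  shows "fps_lim (\<lambda>M. mode_inv \<omega> (F M)) (mode_inv \<omega> G)"
  using assms by (cases \<omega>) (auto simp: mode_inv_def fps_lim_inverse)

lemma fps_mult_one_minus_nth:
  fixes F :: "'a :: comm_ring_1 fps"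
  shows "(F * (1 - fps_const c * fps_X)) $ n = F $ n - (if n = 0 then 0 else c * F $ (n - 1))"
proof -
  have "F * (1 - fps_const c * fps_X) = F - fps_const c * (fps_X * F)"
    by (simp add: algebra_simps)
  then show ?thesis by simp
qed

text \<open>By the recurrence in \<open>M\<close>, a new index multiplies the generating series by
  one linear factor (\<open>Bullet\<close>) or divides it by that factor
  (\<open>Star\<close>).\<close>

lemma mult_sum_gen_fun:
  "Abs_fps (\<lambda>d. of_int (eps \<omega>) ^ d * mult_sum \<omega> a d M) =
     mode_inv \<omega> (\<Prod>m=1..M. 1 - fps_const (a m) * fps_X)"
proof -
  let ?F = "\<lambda>M. Abs_fps (\<lambda>d. of_int (eps \<omega>) ^ d * mult_sum \<omega> a d M)"
  have F0: "?F 0 = 1"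
  proof (rule fps_ext)
    fix n show "?F 0 $ n = 1 $ n" by (cases n) auto
  qed
  show ?thesis
  proof (cases \<omega>)
    case Bullet
    have "?F (Suc M) = ?F M * (1 - fps_const (a (Suc M)) * fps_X)" for M
    proof (rule fps_ext)
      fix n show "?F (Suc M) $ n = (?F M * (1 - fps_const (a (Suc M)) * fps_X)) $ n"
        by (cases n) (simp_all add: Bullet mult_sum_Suc_Suc fps_mult_one_minus_nth, simp add: distrib_left)
    qed
    then have "?F M = (\<Prod>m=1..M. 1 - fps_const (a m) * fps_X)"
      by (induction M) (simp_all only: F0, simp_all)
    then show ?thesis by (simp add: mode_inv_def Bullet)
  next
    case Star
    \<comment> \<open>The largest index may repeat, so the recurrence has \<open>?F (Suc M)\<close>
      on both sides and is stated without division.\<close>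
    have "?F (Suc M) * (1 - fps_const (a (Suc M)) * fps_X) = ?F M" for M
    proof (rule fps_ext)
      fix n show "(?F (Suc M) * (1 - fps_const (a (Suc M)) * fps_X)) $ n = ?F M $ n"
        by (cases n) (simp_all add: Star mult_sum_Suc_Suc fps_mult_one_minus_nth)
    qed
    note step = this
    have "?F M * (\<Prod>m=1..M. 1 - fps_const (a m) * fps_X) = 1"
    proof (induction M)
      case 0
      then show ?case by (simp add: F0)
    next
      case (Suc M)
      have "?F (Suc M) * (\<Prod>m=1..Suc M. 1 - fps_const (a m) * fps_X) =
          ?F (Suc M) * (1 - fps_const (a (Suc M)) * fps_X) * (\<Prod>m=1..M. 1 - fps_const (a m) * fps_X)"
        by (simp add: prod.nat_ivl_Suc' mult.assoc del: prod.cl_ivl_Suc)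
      then show ?case unfolding step Suc .
    qed
    then have "?F M = inverse (\<Prod>m=1..M. 1 - fps_const (a m) * fps_X)"
      by (subst (asm) mult.commute) (rule fps_inverse_unique[symmetric])
    then show ?thesis by (simp add: mode_inv_def Star)
  qed
qed

section \<open>Coefficients of finite products as sums over compositions\<close>

lemma finite_weak_comps: "finite (weak_comps k n)"
proof (rule finite_subset)
  show "weak_comps k n \<subseteq> {1..k} \<rightarrow>\<^sub>E {..n}"
  proof
    fix ns assume ns: "ns \<in> weak_comps k n"
    have "ns l \<le> n" if "l \<in> {1..k}" for l
      using ns that member_le_sum[of l "{1..k}" ns] by (auto simp: weak_comps_def)
    then show "ns \<in> {1..k} \<rightarrow>\<^sub>E {..n}"
      using ns by (auto simp: weak_comps_def PiE_iff)
  qed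
qed (auto intro: finite_PiE)

text \<open>The iterated Cauchy product, which is the source of the sums over compositions in the
  numbers \<open>A\<close>. The induction splits off the last factor.\<close>

lemma fps_prod_nth_weak_comps:
  fixes F :: "nat \<Rightarrow> complex fps"
  shows "(\<Prod>l=1..k. F l) $ n = (\<Sum>ns\<in>weak_comps k n. \<Prod>l=1..k. F l $ ns l)"
proof (induction k arbitrary: n)
  case 0
  have "weak_comps 0 n = (if n = 0 then {\<lambda>_. undefined} else {})"
    by (auto simp: weak_comps_def)
  then show ?case by simp
next
  case (Suc k)
  have "(\<Sum>ns\<in>weak_comps (Suc k) n. \<Prod>l=1..Suc k. F l $ ns l) =
        (\<Sum>(i, ns)\<in>(SIGMA i:{0..n}. weak_comps k i). (\<Prod>l=1..k. F l $ ns l) * F (Suc k) $ (n - i))"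
  \<comment> \<open>The first component of the pair is the sum of the first \<open>k\<close>
    entries; resetting entry \<open>Suc k\<close> to \<open>undefined\<close> keeps the shortened
    tuple extensional.\<close>
  proof (rule sum.reindex_bij_witness
      [where j = "\<lambda>ns. (n - ns (Suc k), ns(Suc k := undefined))"
         and i = "\<lambda>(i, ns). ns(Suc k := n - i)"])
    fix ns assume "ns \<in> weak_comps (Suc k) n"
    then have ns: "ns \<in> {1..Suc k} \<rightarrow>\<^sub>E UNIV" "(\<Sum>l=1..k. ns l) + ns (Suc k) = n"
      by (auto simp: weak_comps_def)
    have eq: "(\<Sum>l=1..k. (ns(Suc k := undefined)) l) = (\<Sum>l=1..k. ns l)"
      by (rule sum.cong) auto
    show "(n - ns (Suc k), ns(Suc k := undefined)) \<in> (SIGMA i:{0..n}. weak_comps k i)"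
      using ns eq by (auto simp: weak_comps_def PiE_iff extensional_def)
    have "(\<Prod>l=1..k. F l $ ((ns(Suc k := undefined)) l)) = (\<Prod>l=1..k. F l $ ns l)"
      by (rule prod.cong) auto
    then show "(case (n - ns (Suc k), ns(Suc k := undefined)) of
        (i, ns) \<Rightarrow> (\<Prod>l=1..k. F l $ ns l) * F (Suc k) $ (n - i)) = (\<Prod>l=1..Suc k. F l $ ns l)"
      using ns by auto
    show "(case (n - ns (Suc k), ns(Suc k := undefined)) of (i, ns) \<Rightarrow> ns(Suc k := n - i)) = ns"
      using ns by auto
  next
    fix b assume b: "b \<in> (SIGMA i:{0..n}. weak_comps k i)"
    obtain i ns where [simp]: "b = (i, ns)" by (cases b)
    have eq: "(\<Sum>l=1..k. (ns(Suc k := n - i)) l) = (\<Sum>l=1..k. ns l)"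
      by (rule sum.cong) auto
    show "(case b of (i, ns) \<Rightarrow> ns(Suc k := n - i)) \<in> weak_comps (Suc k) n"
      using b eq by (auto simp: weak_comps_def PiE_iff extensional_def)
    show "(n - (case b of (i, ns) \<Rightarrow> ns(Suc k := n - i)) (Suc k),
        (case b of (i, ns) \<Rightarrow> ns(Suc k := n - i))(Suc k := undefined)) = b"
      using b by (auto simp: weak_comps_def PiE_iff extensional_def)
  qed
  also have "\<dots> = (\<Sum>i=0..n. (\<Sum>ns\<in>weak_comps k i. \<Prod>l=1..k. F l $ ns l) * F (Suc k) $ (n - i))"
    by (subst sum.Sigma[symmetric]) (auto simp: finite_weak_comps sum_distrib_right)
  also have "\<dots> = (\<Prod>l=1..Suc k. F l) $ n"
    unfolding Suc[symmetric] by (simp add: fps_mult_nth)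
  finally show ?case by simp
qed

section \<open>The product formula for the sine, coefficientwise\<close>

text \<open>The Taylor series of \<open>sin (a + c t)\<close> in \<open>t\<close>.\<close>
definition sin_fps :: "complex \<Rightarrow> complex \<Rightarrow> complex fps" where
  "sin_fps a c = fps_const (sin a) * fps_cos c + fps_const (cos a) * fps_sin c"

lemma has_fps_expansion_sin_fps: "(\<lambda>t. sin (a + c * t)) has_fps_expansion sin_fps a c"
proof -
  have "(\<lambda>t. sin a * cos (c * t) + cos a * sin (c * t)) has_fps_expansion sin_fps a c"
    unfolding sin_fps_def by (intro fps_expansion_intros)
  then show ?thesis by (simp add: sin_add)
qed

lemma sin_fps_compose: "sin_fps a b oo (fps_const z * fps_X) = sin_fps a (z * b)"
  by (simp add: fps_eq_iff fps_compose_linear sin_fps_def fps_sin_def fps_cos_def power_mult_distrib)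

text \<open>Convergence of Taylor coefficients needs more than the pointwise product formula. On the
  ball the \<open>k\<close>-th factor differs from 1 by at most \<open>r^2 / k^2\<close>, so the
  product converges uniformly, and the pointwise formula identifies the limit.\<close>

lemma uniform_limit_sin_product:
  "uniform_limit (cball 0 r) (\<lambda>n z. of_real pi * z * (\<Prod>k=1..n. 1 - z^2 / of_nat k^2))
     (\<lambda>z::complex. sin (of_real pi * z)) sequentially"
proof (cases "r \<ge> 0")
  case True
  \<comment> \<open>Index 0 carries the factor \<open>pi * z\<close>, which makes the expression one
    product over an initial segment. The bound for the M-test fails at this index, hence its
    eventual form below.\<close>
  define f :: "nat \<Rightarrow> complex \<Rightarrow> complex" where
    "f = (\<lambda>k z. if k = 0 then of_real pi * z else 1 - z^2 / of_nat k^2)"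
  have prod_f: "(\<Prod>k<Suc n. f k z) = of_real pi * z * (\<Prod>k=1..n. 1 - z^2 / of_nat k^2)" for n z
  proof -
    have "(\<Prod>k<Suc n. f k z) = f 0 z * (\<Prod>k=1..n. f k z)"
      by (simp add: lessThan_Suc_atMost atMost_atLeast0 prod.atLeast_Suc_atMost)
    then show ?thesis by (simp add: f_def)
  qed
  have "uniformly_convergent_on (cball 0 r) (\<lambda>n z. \<Prod>k<n. f k z)"
  proof (rule uniformly_convergent_on_prod')
    show "continuous_on (cball 0 r) (f k)" for k
      by (cases "k = 0") (auto simp: f_def intro!: continuous_intros)
    show "uniformly_convergent_on (cball 0 r) (\<lambda>n z. \<Sum>k<n. norm (f k z - 1))"
    proof (rule Weierstrass_m_test'_ev)
      show "\<forall>\<^sub>F k in sequentially. \<forall>z\<in>cball 0 r. norm (norm (f k z - 1)) \<le> r^2 * (1 / real k ^ 2)"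
        using eventually_gt_at_top[of 0]
      proof eventually_elim
        case (elim k)
        have "norm (f k z - 1) \<le> r^2 * (1 / real k ^ 2)" if "norm z \<le> r" for z
          using elim that True
          by (auto simp: f_def norm_divide norm_power divide_simps intro!: power_mono)
        then show ?case by simp
      qed
      show "summable (\<lambda>k. r^2 * (1 / real k ^ 2))"
        using inverse_power_summable[of 2, where 'a = real]
        by (intro summable_mult) (simp add: field_simps)
    qed
  qed auto
  then have "uniform_limit (cball 0 r) (\<lambda>n z. \<Prod>k<n. f k z) (\<lambda>z. lim (\<lambda>n. \<Prod>k<n. f k z)) sequentially"
    by (simp add: uniformly_convergent_uniform_limit_iff)
  then have lim: "uniform_limit (cball 0 r) (\<lambda>n z. \<Prod>k<Suc n. f k z) (\<lambda>z. lim (\<lambda>n. \<Prod>k<n. f k z)) sequentially"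
    by (rule filterlim_compose) (rule filterlim_Suc)
  have "lim (\<lambda>n. \<Prod>k<n. f k z) = sin (of_real pi * z)" for z
  proof (rule limI, rule LIMSEQ_imp_Suc)
    show "(\<lambda>n. \<Prod>k<Suc n. f k z) \<longlonglongrightarrow> sin (of_real pi * z)"
      unfolding prod_f by (rule sin_product_formula_complex)
  qed
  then show ?thesis using lim unfolding prod_f by simp
qed auto

text \<open>The Euler partial product \<open>pi z (1 - z^2/1^2) ... (1 - z^2/n^2)\<close>
  re-expanded around \<open>z = a\<close>.\<close>

definition sin_product_fps :: "complex \<Rightarrow> nat \<Rightarrow> complex fps" where
  "sin_product_fps a n = fps_const (of_real pi) * (fps_const a + fps_X) *
     (\<Prod>k=1..n. 1 - (fps_const a + fps_X)^2 * fps_const (1 / of_nat k^2))"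

text \<open>Uniform limits of holomorphic functions on a ball commute with higher derivatives at its
  centre, so the Taylor coefficients converge.\<close>

lemma fps_lim_sin_product: "fps_lim (sin_product_fps a) (sin_fps (of_real pi * a) (of_real pi))"
  unfolding fps_lim_def
proof
  fix m
  define f where "f = (\<lambda>n z::complex. of_real pi * (a + z) * (\<Prod>k=1..n. 1 - (a + z)^2 * (1 / of_nat k^2)))"
  have "uniform_limit (cball 0 (norm a + 1)) (\<lambda>n z. of_real pi * z * (\<Prod>k=1..n. 1 - z^2 * (1 / of_nat k^2)))
     (\<lambda>z::complex. sin (of_real pi * z)) sequentially"
    using uniform_limit_sin_product by simp
  moreover have "(\<lambda>z. a + z) \<in> ball 0 1 \<rightarrow> cball 0 (norm a + 1)"
    by (auto intro!: norm_triangle_mono)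
  ultimately have "uniform_limit (ball 0 1) f (\<lambda>z. sin (of_real pi * (a + z))) sequentially"
    unfolding f_def by (rule uniform_limit_compose')
  then have lim: "(\<lambda>n. (deriv ^^ m) (f n) 0) \<longlonglongrightarrow> (deriv ^^ m) (\<lambda>z. sin (of_real pi * (a + z))) 0"
    by (rule higher_deriv_complex_uniform_limit) (auto simp: f_def intro!: holomorphic_intros always_eventually)
  have "f n has_fps_expansion sin_product_fps a n" for n
    unfolding f_def sin_product_fps_def by (intro fps_expansion_intros)
  then have 1: "sin_product_fps a n $ m = (deriv ^^ m) (f n) 0 / fact m" for n
    by (rule fps_nth_fps_expansion)
  have "(\<lambda>z. sin (of_real pi * (a + z))) has_fps_expansion sin_fps (of_real pi * a) (of_real pi)"
    using has_fps_expansion_sin_fps[of "of_real pi * a" "of_real pi"] by (simp add: distrib_left)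
  then have 2: "sin_fps (of_real pi * a) (of_real pi) $ m = (deriv ^^ m) (\<lambda>z. sin (of_real pi * (a + z))) 0 / fact m"
    by (rule fps_nth_fps_expansion)
  show "(\<lambda>n. sin_product_fps a n $ m) \<longlonglongrightarrow> sin_fps (of_real pi * a) (of_real pi) $ m"
    unfolding 1 2 by (intro tendsto_divide lim tendsto_const) auto
qed

section \<open>Products over roots of unity\<close>

lemma zeta_root_power: "zeta_root m ^ l = exp (2 * of_real pi * \<i> * of_nat l / of_nat m)"
  by (simp add: zeta_root_def exp_of_nat_mult[symmetric] mult_ac)

lemma zeta_root_power_self: "m \<ge> 1 \<Longrightarrow> zeta_root m ^ m = 1"
  by (simp add: zeta_root_power)

text \<open>Both polynomials have degree at most \<open>m\<close> and agree at \<open>m + 1\<close>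
  points: the \<open>m\<close>-th roots of unity, where both vanish, and 0, where both are
  1.\<close>

lemma prod_zeta_root_poly:
  assumes "m \<ge> 1"
  shows "(\<Prod>l=1..m. [:1, - (zeta_root m ^ l):]) = 1 - monom 1 m"
proof (rule poly_eqI_degree[where A = "insert 0 {z::complex. z ^ m = 1}"])
  fix x assume x: "x \<in> insert 0 {z::complex. z ^ m = 1}"
  show "poly (\<Prod>l=1..m. [:1, - (zeta_root m ^ l):]) x = poly (1 - monom 1 m) x"
  proof (cases "x = 0")
    case True
    then show ?thesis using assms by (simp add: poly_prod poly_monom power_0_left)
  next
    case False
    with x have x: "x ^ m = 1" by auto
    then have "x \<in> {exp (2 * of_real pi * \<i> * of_nat j / of_nat m) | j. j < m}"
      using complex_roots_unity[OF assms] by blast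
    then obtain j where j: "j < m" "x = zeta_root m ^ j"
      by (auto simp: zeta_root_power)
    \<comment> \<open>The factor vanishing at \<open>x\<close> has index \<open>m - j\<close>, which
      lies in \<open>{1..m}\<close> even for \<open>j = 0\<close>.\<close>
    have "zeta_root m ^ (m - j) * x = 1"
      using j zeta_root_power_self[OF assms] by (simp add: power_add[symmetric])
    then have "1 - x * zeta_root m ^ (m - j) = 0" by (simp add: mult.commute)
    moreover have "m - j \<in> {1..m}" using j by auto
    ultimately have "\<exists>l\<in>{1..m}. 1 - x * zeta_root m ^ l = 0" by blast
    then show ?thesis using x by (simp add: poly_prod poly_monom)
  qed
next
  have card: "card (insert 0 {z::complex. z ^ m = 1}) = Suc m"
    using assms card_complex_roots_unity[OF assms] finite_complex_roots_unity_explicit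
    by (subst card_insert_disjoint) (auto simp: power_0_left intro: card_ge_0_finite)
  have "degree (\<Prod>l=1..m. [:1, - (zeta_root m ^ l):]) \<le> (\<Sum>l=1..m. degree [:1, - (zeta_root m ^ l):])"
    using degree_prod_sum_le[of "{1..m}" "\<lambda>l. [:1, - (zeta_root m ^ l):]"] by (simp add: o_def)
  also have "\<dots> \<le> (\<Sum>l=1..m. 1)" by (intro sum_mono) auto
  finally show "degree (\<Prod>l=1..m. [:1, - (zeta_root m ^ l):]) < card (insert 0 {z::complex. z ^ m = 1})"
    using card by simp
  have "degree (1 - monom 1 m :: complex poly) \<le> m"
    by (rule degree_diff_le) (auto simp: degree_monom_le)
  then show "degree (1 - monom 1 m :: complex poly) < card (insert 0 {z::complex. z ^ m = 1})"
    using card by simp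
qed

text \<open>Substitution of \<open>c X\<close> into the polynomial identity. It produces linear
  factors, which can be matched with those of a sine product.\<close>

lemma prod_zeta_root_fps:
  assumes "m \<ge> 1"
  shows "(\<Prod>l=1..m. 1 - fps_const (zeta_root m ^ l * c) * fps_X) = 1 - fps_const (c ^ m) * fps_X ^ m"
proof -
  let ?c = "fps_const c * fps_X :: complex fps"
  have "fps_of_poly (\<Prod>l=1..m. [:1, - (zeta_root m ^ l):]) = fps_of_poly (1 - monom 1 m)"
    using prod_zeta_root_poly[OF assms] by simp
  then have "(\<Prod>l=1..m. 1 - fps_const (zeta_root m ^ l) * fps_X) = 1 - fps_X ^ m"
    by (simp add: fps_of_poly_prod fps_of_poly_pCons fps_of_poly_diff fps_of_poly_monom mult.commute flip: fps_const_neg)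
  then have "(\<Prod>l=1..m. 1 - fps_const (zeta_root m ^ l) * fps_X) oo ?c = (1 - fps_X ^ m) oo ?c" by simp
  then show ?thesis
    by (simp add: fps_compose_prod_distrib fps_compose_sub_distrib fps_compose_mult_distrib
        fps_compose_power[symmetric] power_mult_distrib mult.assoc[symmetric])
qed

text \<open>The factor with \<open>l = m\<close> is \<open>1 - X\<close>; cancelling it from
  \<open>1 - X^m\<close> leaves a geometric sum, with value \<open>m\<close> at 1.\<close>

lemma prod_one_minus_zeta_root:
  assumes "m \<ge> 1"
  shows "(\<Prod>l=1..m-1. 1 - zeta_root m ^ l) = of_nat m"
proof -
  have m: "{1..m} = insert m {1..m-1}" using assms by auto
  have "[:1, -1:] * (\<Prod>l=1..m-1. [:1, - (zeta_root m ^ l):]) = 1 - monom 1 m"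
    unfolding prod_zeta_root_poly[OF assms, symmetric] m
    using assms by (subst prod.insert) (auto simp: zeta_root_power_self)
  also have "\<dots> = 1 - (monom 1 1) ^ m" by (simp add: monom_power)
  also have "\<dots> = (1 - monom 1 1) * (\<Sum>i<m. (monom 1 1) ^ i)" by (rule one_diff_power_eq)
  also have "1 - monom 1 1 = ([:1, -1:] :: complex poly)" by (simp add: monom_altdef one_pCons)
  finally have "(\<Prod>l=1..m-1. [:1, - (zeta_root m ^ l):]) = (\<Sum>i<m. (monom 1 1) ^ i)"
    by (subst (asm) mult_cancel_left) auto
  then have "poly (\<Prod>l=1..m-1. [:1, - (zeta_root m ^ l):]) 1 = poly (\<Sum>i<m. (monom 1 1) ^ i) 1" by simp
  then show ?thesis by (simp add: poly_prod poly_sum poly_monom)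
qed

section \<open>Sine products behind the constant \<open>C\<close>\<close>

lemma norm_one_minus_cis: "norm (1 - cis x) = 2 * \<bar>sin (x / 2)\<bar>"
proof -
  have "(norm (1 - cis x))\<^sup>2 = (1 - cos x)\<^sup>2 + (sin x)\<^sup>2"
    by (simp add: cmod_power2)
  also have "\<dots> = 2 - 2 * cos x" using sin_cos_squared_add[of x] by (simp add: power2_eq_square algebra_simps)
  also have "\<dots> = (2 * \<bar>sin (x / 2)\<bar>)\<^sup>2"
    using cos_double_sin[of "x / 2"] by (simp add: power_mult_distrib)
  finally show ?thesis by (subst (asm) power2_eq_iff_nonneg) auto
qed

lemma prod_sin_pi_over:
  assumes "m \<ge> 1"
  shows "(\<Prod>l=1..m-1. sin (pi * real l / real m)) = real m / 2 ^ (m - 1)"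
proof -
  have "real m = norm (\<Prod>l=1..m-1. 1 - zeta_root m ^ l)"
    using prod_one_minus_zeta_root[OF assms] by simp
  also have "\<dots> = (\<Prod>l=1..m-1. norm (1 - zeta_root m ^ l))" by (simp add: prod_norm)
  also have "\<dots> = (\<Prod>l=1..m-1. 2 * sin (pi * real l / real m))"
  proof (rule prod.cong[OF refl])
    fix l assume l: "l \<in> {1..m-1}"
    have "zeta_root m ^ l = cis (2 * (pi * real l / real m))"
      by (simp add: zeta_root_power cis_conv_exp mult_ac)
    moreover have "sin (pi * real l / real m) \<ge> 0"
      using l by (intro sin_ge_zero) (auto simp: field_simps)
    ultimately show "norm (1 - zeta_root m ^ l) = 2 * sin (pi * real l / real m)"
      by (simp add: norm_one_minus_cis)
  qed
  finally show ?thesis by (simp add: prod.distrib field_simps)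
qed

text \<open>The reflection sending \<open>j\<close> to \<open>m - j\<close> pairs the factors of the
  full product. The value explains the powers of \<open>N\<close> and 2 in \<open>C_num\<close> for
  \<open>N \<ge> 3\<close>.\<close>

lemma prod_sin_half:
  assumes "m \<ge> 1"
  shows "(\<Prod>j=1..(m - 1) div 2. sin (pi * real j / real m)) ^ 2 = real m / 2 ^ (m - 1)"
proof -
  define h where "h = (m - 1) div 2"
  define g where "g = (\<lambda>j. sin (pi * real j / real m))"
  have refl_g: "g (m - j) = g j" if "j \<le> m" for j
  proof -
    have "pi * real (m - j) / real m = pi - pi * real j / real m"
      using that assms by (simp add: of_nat_diff field_simps)
    then show ?thesis by (simp add: g_def)
  qed
  have "h \<le> m - 1" by (simp add: h_def)
  have "{1..m-1} = {1..h} \<union> {h+1..m-1}" using \<open>h \<le> m - 1\<close> by auto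
  then have "prod g {1..m-1} = prod g {1..h} * prod g {h+1..m-1}"
    by (simp add: prod.union_disjoint)
  also have "prod g {h+1..m-1} = prod g {1..m-1-h}"
  proof (rule prod.reindex_bij_witness[of _ "\<lambda>j. m - j" "\<lambda>j. m - j"])
    show "g (m - j) = g j" if "j \<in> {h+1..m-1}" for j
      using that by (intro refl_g) auto
  qed (use assms \<open>h \<le> m - 1\<close> in auto)
  \<comment> \<open>For even \<open>m\<close> the reflected range has the extra element
    \<open>Suc h = m / 2\<close>, whose factor is \<open>sin (pi / 2) = 1\<close>.\<close>
  also have "prod g {1..m-1-h} = prod g {1..h}"
  proof (cases "odd m")
    case True
    then have "m - 1 - h = h" by (auto simp: h_def elim!: oddE)
    then show ?thesis by simp
  next
    case False
    then obtain b where "m = 2 * b" by blast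
    with assms obtain c where c: "m = 2 * Suc c" by (cases b) auto
    then have m: "m - 1 - h = Suc h" "m = 2 * Suc h" by (simp_all add: h_def)
    have "pi * real (Suc h) / real m = pi / 2"
      by (subst m(2)) (simp add: field_simps)
    then have "g (Suc h) = 1" unfolding g_def by (simp only: sin_pi_half)
    then show ?thesis unfolding m(1) by simp
  qed
  finally show ?thesis
    using prod_sin_pi_over[OF assms] by (simp add: g_def h_def power2_eq_square)
qed

section \<open>Limits of the truncated sums\<close>

text \<open>Finitely many residue classes admit a common threshold, and from \<open>s\<close> on
  every index is reached by dividing \<open>M - s\<close> by \<open>N\<close> with
  remainder.\<close>

lemma LIMSEQ_residue_classes:
  fixes f :: "nat \<Rightarrow> 'a :: topological_space"
  assumes "N \<ge> 1" and lim: "\<And>i. i < N \<Longrightarrow> (\<lambda>R. f (N * R + s + i)) \<longlonglongrightarrow> L"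
  shows "f \<longlonglongrightarrow> L"
proof (rule topological_tendstoI)
  fix S assume S: "open S" "L \<in> S"
  have "\<forall>\<^sub>F R in sequentially. \<forall>i\<in>{..<N}. f (N * R + s + i) \<in> S"
    using lim S by (intro eventually_ball_finite) (auto dest: topological_tendstoD)
  then obtain R0 where R0: "\<And>R i. R \<ge> R0 \<Longrightarrow> i < N \<Longrightarrow> f (N * R + s + i) \<in> S"
    by (auto simp: eventually_sequentially)
  show "\<forall>\<^sub>F M in sequentially. f M \<in> S"
    using eventually_ge_at_top[of "N * R0 + s"]
  proof eventually_elim
    case (elim M)
    have "R0 = N * R0 div N" using assms(1) by simp
    also have "\<dots> \<le> (M - s) div N" using elim by (intro div_le_mono) simp
    finally have "f (N * ((M - s) div N) + s + (M - s) mod N) \<in> S"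
      using assms(1) by (intro R0) auto
    moreover have "N * ((M - s) div N) + s + (M - s) mod N = M"
      using elim by (simp add: algebra_simps)
    ultimately show ?case by simp
  qed
qed

text \<open>Passing from length \<open>N * R + s\<close> to \<open>N * R + s + i\<close> multiplies
  by \<open>i\<close> factors that tend to 1. Hence convergence along one progression gives
  convergence of all partial products, without absolute convergence.\<close>

lemma fps_lim_partial_product:
  assumes a: "a \<longlonglongrightarrow> 0" and N: "N \<ge> 1"
    and lim: "fps_lim (\<lambda>R. \<Prod>m=1..N * R + s. 1 - fps_const (a m) * fps_X) G"
  shows "fps_lim (\<lambda>M. \<Prod>m=1..M. 1 - fps_const (a m) * fps_X) G"
proof -
  define D where "D = (\<lambda>M. \<Prod>m=1..M. 1 - fps_const (a m) * fps_X)"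
  have *: "fps_lim (\<lambda>R. D (N * R + s + i)) G" for i
  proof (induction i)
    case 0
    then show ?case using lim by (simp add: D_def)
  next
    case (Suc i)
    have "strict_mono (\<lambda>R. N * R + s + Suc i)"
      using N by (auto intro!: strict_monoI)
    then have "(\<lambda>R. a (N * R + s + Suc i)) \<longlonglongrightarrow> 0"
      using LIMSEQ_subseq_LIMSEQ[OF a] by (simp add: o_def)
    then have "fps_lim (\<lambda>R. 1 - fps_const (a (N * R + s + Suc i)) * fps_X) (1 - fps_const 0 * fps_X)"
      by (intro fps_lim_diff fps_lim_mult fps_lim_const fps_lim_fps_const)
    with Suc have "fps_lim (\<lambda>R. D (N * R + s + i) * (1 - fps_const (a (N * R + s + Suc i)) * fps_X))
                     (G * (1 - fps_const 0 * fps_X))"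
      by (rule fps_lim_mult)
    then show ?case by (simp add: D_def)
  qed
  have "fps_lim D G"
    unfolding fps_lim_def
  proof
    fix n
    show "(\<lambda>M. D M $ n) \<longlonglongrightarrow> G $ n"
      by (rule LIMSEQ_residue_classes[OF N, where s = s]) (use * in \<open>auto simp: fps_lim_def\<close>)
  qed
  then show ?thesis by (simp add: D_def)
qed

text \<open>The truncated products are series in \<open>X^p\<close>, hence so are \<open>G\<close>
  and \<open>mode_inv \<omega> G\<close>. Coefficients at multiples of \<open>p\<close> are, up to
  sign, the limits of the truncated sums; the vanishing of the others later gives the vanishing of
  \<open>A_num\<close>.\<close>

lemma mult_sum_limit:
  assumes a: "a \<longlonglongrightarrow> 0" and N: "N \<ge> 1" and p: "p \<ge> 1"
    and lim: "fps_lim (\<lambda>R. \<Prod>m=1..N * R + s. 1 - fps_const (a m) * fps_X ^ p) G"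
  shows mult_sum_tendsto: "(\<lambda>M. mult_sum \<omega> a d M) \<longlonglongrightarrow> of_int (eps \<omega>) ^ d * mode_inv \<omega> G $ (p * d)"
    and mode_inv_nth_eq_0: "\<not> p dvd n \<Longrightarrow> mode_inv \<omega> G $ n = 0"
proof -
  define D where "D = (\<lambda>M. \<Prod>m=1..M. 1 - fps_const (a m) * fps_X)"
  define G0 where "G0 = Abs_fps (\<lambda>n. G $ (p * n))"
  have p0: "(fps_X ^ p :: complex fps) $ 0 = 0" using p by (simp add: fps_X_power_nth)
  have D_comp: "D M oo fps_X ^ p = (\<Prod>m=1..M. 1 - fps_const (a m) * fps_X ^ p)" for M
    using p0 by (simp add: D_def fps_compose_prod_distrib fps_compose_sub_distrib fps_compose_mult_distrib)
  have lim': "fps_lim (\<lambda>R. D (N * R + s) oo fps_X ^ p) G"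
    using lim by (simp add: D_comp)
  have "G $ n = 0" if "\<not> p dvd n" for n
  proof -
    have "(\<lambda>R. (D (N * R + s) oo fps_X ^ p) $ n) \<longlonglongrightarrow> G $ n"
      using lim' by (simp add: fps_lim_def)
    then show ?thesis using that by (simp add: fps_nth_compose_X_power LIMSEQ_const_iff)
  qed
  then have G: "G = G0 oo fps_X ^ p"
    by (auto simp: fps_eq_iff fps_nth_compose_X_power G0_def)
  have "fps_lim (\<lambda>R. D (N * R + s)) G0"
    using lim' p unfolding G by (subst (asm) fps_lim_compose_power_iff) auto
  then have D: "fps_lim D G0"
    unfolding D_def by (rule fps_lim_partial_product[OF a N])
  have "D M $ 0 = 1" for M
    by (simp add: D_def fps_prod_nth')
  then have G0: "G0 $ 0 = 1"
    using D[unfolded fps_lim_def, rule_format, of 0] by (simp add: LIMSEQ_const_iff)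
  have inv_G: "mode_inv \<omega> G = mode_inv \<omega> G0 oo fps_X ^ p"
    unfolding G by (rule mode_inv_compose) (use G0 p0 in auto)
  show "mode_inv \<omega> G $ n = 0" if "\<not> p dvd n"
    using that by (simp add: inv_G fps_nth_compose_X_power)
  have eps_sq: "of_int (eps \<omega>) ^ d * (of_int (eps \<omega>) ^ d * x) = x" for x :: complex
    by (cases \<omega>) (auto simp: mult.assoc[symmetric] power_mult_distrib[symmetric])
  have "fps_lim (\<lambda>M. Abs_fps (\<lambda>d. of_int (eps \<omega>) ^ d * mult_sum \<omega> a d M)) (mode_inv \<omega> G0)"
    using fps_lim_mode_inv[OF D] G0 unfolding mult_sum_gen_fun D_def by simp
  then have "(\<lambda>M. of_int (eps \<omega>) ^ d * (of_int (eps \<omega>) ^ d * mult_sum \<omega> a d M))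
      \<longlonglongrightarrow> of_int (eps \<omega>) ^ d * mode_inv \<omega> G0 $ d"
    by (intro tendsto_mult_left) (simp add: fps_lim_def)
  then show "(\<lambda>M. mult_sum \<omega> a d M) \<longlonglongrightarrow> of_int (eps \<omega>) ^ d * mode_inv \<omega> G $ (p * d)"
    using p by (simp add: eps_sq inv_G fps_nth_compose_X_power)
qed

lemma mult_L_partial_replicate:
  "mult_L_partial \<omega> (replicate d (of_nat \<kappa>)) (replicate d f) M
     = mult_sum \<omega> (\<lambda>m. f m / of_nat m ^ \<kappa>) d M"
proof -
  have "mult_L_term (replicate d (of_nat \<kappa>)) (replicate d f) ms = prod_list (map (\<lambda>m. f m / of_nat m ^ \<kappa>) ms)"
    if "ms \<in> index_set \<omega> d" for ms
  proof -
    have len: "length ms = d" and pos: "\<And>m. m \<in> set ms \<Longrightarrow> m \<ge> 1"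
      using that by (auto simp: index_set_def)
    have "f (ms ! j) * of_nat (ms ! j) powr (- of_nat \<kappa>) = f (ms ! j) / of_nat (ms ! j) ^ \<kappa>"
      if "j < d" for j
      using pos[of "ms ! j"] that len by (simp add: powr_minus powr_nat divide_inverse)
    then show ?thesis
      by (simp add: mult_L_term_def prod.list_conv_set_nth len atLeast0LessThan)
  qed
  then show ?thesis
    by (simp add: mult_L_partial_def mult_sum_def bounded_index_set_def)
qed

text \<open>The power of the root of unity in the numbers \<open>A\<close> arises from rescaling the
  variable of the \<open>l\<close>-th copy by \<open>z ^ l\<close>; the common scale
  \<open>c\<close> contributes \<open>c ^ n\<close>.\<close>

lemma prod_compose_zeta_nth:
  fixes F :: "complex fps"
  shows "(\<Prod>l=1..k. F oo (fps_const (z ^ l * c) * fps_X)) $ n =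
     c ^ n * (\<Sum>ns\<in>weak_comps k n. (\<Prod>l=1..k. F $ ns l) * z ^ (\<Sum>l=1..k. l * ns l))"
  unfolding fps_prod_nth_weak_comps sum_distrib_left
proof (rule sum.cong[OF refl])
  fix ns assume "ns \<in> weak_comps k n"
  then have "c ^ n = (\<Prod>l=1..k. c ^ ns l)" by (auto simp: weak_comps_def simp flip: power_sum)
  then show "(\<Prod>l=1..k. (F oo (fps_const (z ^ l * c) * fps_X)) $ ns l) =
      c ^ n * ((\<Prod>l=1..k. F $ ns l) * z ^ (\<Sum>l=1..k. l * ns l))"
    by (simp add: fps_compose_linear power_mult_distrib power_mult prod.distrib power_sum)
qed

section \<open>The moduli 1 and 2\<close>

text \<open>The series of \<open>sin (c x) / (c x)\<close> and of \<open>cos (c x)\<close> in the variable \<open>x\<^sup>2\<close>.\<close>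
definition sinc_fps :: "complex \<Rightarrow> complex fps" where
  "sinc_fps c = Abs_fps (\<lambda>n. (-1) ^ n * c ^ (2 * n) / fact (2 * n + 1))"

definition cos_sqrt_fps :: "complex \<Rightarrow> complex fps" where
  "cos_sqrt_fps c = Abs_fps (\<lambda>n. (-1) ^ n * c ^ (2 * n) / fact (2 * n))"

lemma fps_X_sq_nth_0: "(fps_X ^ 2 :: complex fps) $ 0 = 0"
  by (simp add: fps_X_power_nth)

lemma fps_sin_eq_sinc: "fps_sin c = fps_const c * fps_X * (sinc_fps c oo fps_X ^ 2)"
proof (rule fps_ext)
  fix n
  show "fps_sin c $ n = (fps_const c * fps_X * (sinc_fps c oo fps_X ^ 2)) $ n"
  proof (cases "even n")
    case True
    then show ?thesis
      by (cases n) (auto simp: fps_sin_def mult.assoc fps_nth_compose_X_power)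
  next
    case False
    then obtain m where "n = Suc (2 * m)" by (auto elim: oddE)
    then show ?thesis
      by (auto simp: fps_sin_def mult.assoc fps_nth_compose_X_power sinc_fps_def algebra_simps)
  qed
qed

lemma fps_cos_eq_cos_sqrt: "fps_cos c = cos_sqrt_fps c oo fps_X ^ 2"
  by (auto simp: fps_eq_iff fps_cos_def fps_nth_compose_X_power cos_sqrt_fps_def)

lemma fps_compose_X_power_inj:
  fixes F G :: "complex fps"
  assumes "F oo fps_X ^ p = G oo fps_X ^ p" "p \<ge> 1"
  shows "F = G"
proof (rule fps_ext)
  fix n
  show "F $ n = G $ n"
    using arg_cong[OF assms(1), of "\<lambda>H. H $ (p * n)"] assms(2) by (simp add: fps_nth_compose_X_power)
qed

text \<open>The identity \<open>sin (2 y) = 2 sin y cos y\<close> divided by \<open>2 y\<close>,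
  read between series in the square of the variable.\<close>

lemma sinc_fps_double:
  assumes "c \<noteq> 0"
  shows "sinc_fps (2 * c) = cos_sqrt_fps c * sinc_fps c"
proof (rule fps_compose_X_power_inj[where p = 2])
  have "fps_const (2 * c) * fps_X * (sinc_fps (2 * c) oo fps_X ^ 2) = fps_sin (c + c)"
    by (simp only: fps_sin_eq_sinc[symmetric] mult_2)
  also have "\<dots> = fps_const 2 * fps_cos c * fps_sin c"
    unfolding fps_sin_add by (simp only: numeral_fps_const[symmetric]) (simp add: algebra_simps)
  also have "\<dots> = fps_const 2 * (cos_sqrt_fps c oo fps_X ^ 2) *
      (fps_const c * fps_X * (sinc_fps c oo fps_X ^ 2))"
    by (simp only: fps_sin_eq_sinc fps_cos_eq_cos_sqrt)
  also have "\<dots> = fps_const 2 * fps_const c * fps_X *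
      ((cos_sqrt_fps c oo fps_X ^ 2) * (sinc_fps c oo fps_X ^ 2))"
    by (simp only: mult_ac)
  also have "\<dots> = fps_const (2 * c) * fps_X * ((cos_sqrt_fps c * sinc_fps c) oo fps_X ^ 2)"
    by (simp only: fps_const_mult fps_compose_mult_distrib[OF fps_X_sq_nth_0])
  finally show "sinc_fps (2 * c) oo fps_X ^ 2 = (cos_sqrt_fps c * sinc_fps c) oo fps_X ^ 2"
    using assms by simp
qed simp

lemma sinc_fps_compose: "sinc_fps c oo (fps_const (z ^ 2) * fps_X) = sinc_fps (z * c)"
  by (simp add: fps_eq_iff fps_compose_linear sinc_fps_def power_mult power_mult_distrib)

text \<open>The Euler product at \<open>a = 0\<close>: removing the factor \<open>pi X\<close>
  leaves series in \<open>X^2\<close>, so coefficient \<open>n\<close> is read off at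
  \<open>2 n + 1\<close>.\<close>

lemma fps_lim_sinc:
  "fps_lim (\<lambda>M. \<Prod>m=1..M. 1 - fps_const (1 / of_nat m ^ 2) * fps_X) (sinc_fps (of_real pi))"
proof -
  define Q where "Q = (\<lambda>M. \<Prod>m=1..M. 1 - fps_const (1 / of_nat m ^ 2) * fps_X :: complex fps)"
  have eq: "sin_product_fps 0 M = fps_const (of_real pi) * (fps_X * (Q M oo fps_X ^ 2))" for M
    unfolding sin_product_fps_def Q_def
    by (simp add: fps_compose_prod_distrib fps_X_sq_nth_0 fps_compose_sub_distrib fps_compose_mult_distrib
        mult.assoc mult.commute[of "fps_X ^ 2"])
  have eq': "sin_fps 0 (of_real pi) = fps_const (of_real pi) * (fps_X * (sinc_fps (of_real pi) oo fps_X ^ 2))"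
    by (simp add: sin_fps_def fps_sin_eq_sinc mult.assoc)
  have lim: "fps_lim (sin_product_fps 0) (sin_fps 0 (of_real pi))"
    using fps_lim_sin_product[of 0] by simp
  have "(\<lambda>M. Q M $ n) \<longlonglongrightarrow> sinc_fps (of_real pi) $ n" for n
  proof -
    have "(\<lambda>M. of_real pi * Q M $ n) \<longlonglongrightarrow> of_real pi * sinc_fps (of_real pi) $ n"
      using lim[unfolded fps_lim_def, rule_format, of "Suc (2 * n)"]
      by (simp add: eq eq' fps_nth_compose_X_power)
    then show ?thesis by (subst (asm) tendsto_mult_left_iff) auto
  qed
  then show ?thesis by (simp add: fps_lim_def Q_def)
qed

text \<open>The formal quotient in \<open>bernoulli_num\<close> is exact because
  \<open>fps_exp 1 - 1\<close> has a nonzero coefficient at 1 and so divides \<open>fps_X\<close>;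
  substituting \<open>c X\<close> gives the scaled form.\<close>

lemma bernoulli_fps:
  "Abs_fps (\<lambda>n. c ^ n * bernoulli_num n / fact n) * (fps_exp c - 1) = fps_const c * fps_X"
proof -
  define b :: "complex fps" where "b = fps_X / (fps_exp 1 - 1)"
  have nz: "(fps_exp 1 - 1 :: complex fps) $ 1 \<noteq> 0" by simp
  then have nz': "(fps_exp 1 - 1 :: complex fps) \<noteq> 0" by (metis fps_zero_nth)
  have "subdegree (fps_exp 1 - 1 :: complex fps) \<le> 1"
    using nz by (rule subdegree_leI)
  then have "(fps_exp 1 - 1 :: complex fps) dvd fps_X"
    using nz' by (subst fps_dvd_iff) auto
  then have "b * (fps_exp 1 - 1) = fps_X" by (simp add: b_def)
  then have "(b * (fps_exp 1 - 1)) oo (fps_const c * fps_X) = fps_X oo (fps_const c * fps_X)" by simp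
  then have "(b oo (fps_const c * fps_X)) * (fps_exp c - 1) = fps_const c * fps_X"
    by (simp add: fps_compose_mult_distrib fps_compose_sub_distrib)
  moreover have "b oo (fps_const c * fps_X) = Abs_fps (\<lambda>n. c ^ n * bernoulli_num n / fact n)"
    by (simp add: fps_eq_iff fps_compose_linear bernoulli_num_def b_def)
  ultimately show ?thesis by simp
qed

text \<open>With \<open>b(x) = x / (e\<^sup>x - 1)\<close>, one has \<open>x / sinh x = 2 b(x) - b(2 x)\<close>, used here at an imaginary argument.\<close>
lemma inverse_sinc_fps_nth:
  assumes "c \<noteq> 0"
  shows "inverse (sinc_fps c) $ n = (-1) ^ (n + 1) * c ^ (2 * n) * (2 ^ (2 * n) - 2) * bernoulli_num (2 * n) / fact (2 * n)"
proof -
  define b where "b = (\<lambda>c. Abs_fps (\<lambda>n. c ^ n * bernoulli_num n / fact n))"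
  define E where "E = fps_exp (\<i> * c)"
  have E: "E * fps_exp (- (\<i> * c)) = 1" by (simp add: E_def flip: fps_exp_add_mult)
  have b1: "b (\<i> * c) * (E - 1) = fps_const (\<i> * c) * fps_X"
    unfolding b_def E_def by (rule bernoulli_fps)
  have "fps_exp (2 * (\<i> * c)) = E * E" by (simp add: E_def flip: fps_exp_add_mult)
  then have b2: "b (2 * (\<i> * c)) * (E * E - 1) = 2 * (fps_const (\<i> * c) * fps_X)"
    using bernoulli_fps[of "2 * (\<i> * c)"] unfolding b_def
    by (simp add: mult.assoc flip: numeral_fps_const fps_const_mult)
  define B where "B = 2 * b (\<i> * c) - b (2 * (\<i> * c))"
  \<comment> \<open>\<open>E * E - 1 = (E + 1) * (E - 1)\<close> clears both denominators. Writing 1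
    as \<open>E * fps_exp (- (\<i> * c))\<close> then lets \<open>E\<close> cancel and leaves the
    exponential form of the sine.\<close>
  have "(E * E - 1) * B = 2 * (E + 1) * (b (\<i> * c) * (E - 1)) - b (2 * (\<i> * c)) * (E * E - 1)"
    by (simp add: B_def algebra_simps)
  also have "\<dots> = E * (2 * (fps_const (\<i> * c) * fps_X))"
    unfolding b1 b2 by (simp add: algebra_simps)
  finally have "E * (2 * (fps_const (\<i> * c) * fps_X)) = (E * E - E * fps_exp (- (\<i> * c))) * B"
    by (simp add: E)
  also have "\<dots> = E * ((E - fps_exp (- (\<i> * c))) * B)" by (simp add: algebra_simps)
  finally have "2 * (fps_const (\<i> * c) * fps_X) = (E - fps_exp (- (\<i> * c))) * B"
    by (subst (asm) mult_cancel_left) (auto simp: E_def)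
  also have "E - fps_exp (- (\<i> * c)) = fps_const (2 * \<i>) * fps_sin c"
  proof -
    have "fps_const (2 * \<i>) * fps_sin c = fps_exp (\<i> * c) - fps_exp (- (\<i> * c))"
      unfolding fps_sin_fps_exp_ii by (simp add: fps_divide_unit mult.assoc mult.left_commute)
    then show ?thesis by (simp add: E_def)
  qed
  also have "fps_const (2 * \<i>) * fps_sin c * B = 2 * (fps_const (\<i> * c) * fps_X) * ((sinc_fps c oo fps_X ^ 2) * B)"
    unfolding fps_sin_eq_sinc by (simp add: mult_ac flip: numeral_fps_const fps_const_mult)
  finally have "2 * (fps_const (\<i> * c) * fps_X) * 1 = 2 * (fps_const (\<i> * c) * fps_X) * ((sinc_fps c oo fps_X ^ 2) * B)"
    by simp
  then have "(sinc_fps c oo fps_X ^ 2) * B = 1"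
    using assms by (subst (asm) mult_cancel_left) auto
  then have "B = inverse (sinc_fps c oo fps_X ^ 2)"
    by (rule fps_inverse_unique[symmetric])
  also have "\<dots> = inverse (sinc_fps c) oo fps_X ^ 2"
    by (rule fps_inverse_compose[symmetric]) (auto simp: fps_X_sq_nth_0 sinc_fps_def)
  finally have "inverse (sinc_fps c) $ n = B $ (2 * n)"
    by (simp add: fps_nth_compose_X_power)
  also have "\<dots> = (2 - 2 ^ (2 * n)) * (\<i> * c) ^ (2 * n) * bernoulli_num (2 * n) / fact (2 * n)"
    by (simp add: B_def b_def numeral_fps_const power_mult_distrib field_simps)
  also have "(\<i> * c) ^ (2 * n) = ((-1) * c ^ 2) ^ n"
    by (simp add: power_mult_distrib power_mult)
  also have "\<dots> = (-1) ^ n * c ^ (2 * n)"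
    by (simp only: power_mult_distrib power_mult)
  finally show ?thesis by (simp add: algebra_simps)
qed

lemma inverse_cos_sqrt_fps_nth:
  "inverse (cos_sqrt_fps c) $ n = (-1) ^ n * c ^ (2 * n) * euler_num (2 * n) / fact (2 * n)"
proof -
  have "fps_cos c = fps_cos 1 oo (fps_const c * fps_X)"
    by (auto simp: fps_eq_iff fps_compose_linear fps_cos_def)
  then have "inverse (fps_cos c) = inverse (fps_cos 1) oo (fps_const c * fps_X)"
    by (simp add: fps_inverse_compose fps_cos_def)
  moreover have "inverse (fps_cos c) = inverse (cos_sqrt_fps c) oo fps_X ^ 2"
    unfolding fps_cos_eq_cos_sqrt
    by (rule fps_inverse_compose[symmetric]) (auto simp: fps_X_sq_nth_0 cos_sqrt_fps_def)
  ultimately have "inverse (cos_sqrt_fps c) oo fps_X ^ 2 = inverse (fps_cos 1) oo (fps_const c * fps_X)"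
    by simp
  from arg_cong[OF this, of "\<lambda>F. F $ (2 * n)"]
  have "inverse (cos_sqrt_fps c) $ n = c ^ (2 * n) * inverse (fps_cos 1) $ (2 * n)"
    by (simp add: fps_nth_compose_X_power fps_compose_linear)
  then show ?thesis by (simp add: euler_num_def flip: power_mult_distrib)
qed

text \<open>The product over odd indices is that over all indices up to \<open>2 M\<close> divided
  by that over even ones. The limits are \<open>sinc_fps\<close> at \<open>pi\<close> and
  \<open>pi / 2\<close>, whose quotient is the cosine by the duplication formula.\<close>

lemma fps_lim_cos_sqrt:
  "fps_lim (\<lambda>M. \<Prod>m=1..M. 1 - fps_const (1 / of_nat (2 * m - 1) ^ 2) * fps_X) (cos_sqrt_fps (of_real pi / 2))"
proof -
  define u where "u = (\<lambda>m. 1 - fps_const (1 / of_nat m ^ 2) * fps_X :: complex fps)"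
  define Q where "Q = (\<lambda>M. \<Prod>m=1..M. u m)"
  define P where "P = (\<lambda>M. \<Prod>m=1..M. u (2 * m - 1))"
  \<comment> \<open>Scaling the variable by 1/4 replaces \<open>1 / m^2\<close> by
    \<open>1 / (2 m)^2\<close>, which gives the even-indexed factors.\<close>
  define Q' where "Q' = (\<lambda>M. Q M oo (fps_const ((1/2)^2) * fps_X))"
  have Q': "Q' M = (\<Prod>m=1..M. u (2 * m))" for M
    unfolding Q'_def Q_def u_def
    by (simp add: fps_compose_prod_distrib fps_compose_sub_distrib fps_compose_mult_distrib
        power_mult_distrib power_divide mult.commute[of 4] flip: mult.assoc)
  have Q'0: "Q' M $ 0 \<noteq> 0" for M
    by (simp add: Q' u_def fps_prod_nth')
  have "P M * Q' M = Q (2 * M)" for M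
    by (induction M) (simp_all add: P_def Q' Q_def mult_ac)
  then have P: "P M = Q (2 * M) * inverse (Q' M)" for M
    using inverse_mult_eq_1'[OF Q'0, of M] by (metis mult.assoc mult.right_neutral)
  have Q: "fps_lim Q (sinc_fps (of_real pi))"
    unfolding Q_def u_def by (rule fps_lim_sinc)
  have "fps_lim Q' (sinc_fps (of_real pi) oo (fps_const ((1/2)^2) * fps_X))"
    unfolding Q'_def by (rule fps_lim_compose_linear[OF Q])
  then have "fps_lim Q' (sinc_fps (of_real pi / 2))"
    by (simp add: sinc_fps_compose)
  moreover have nz: "sinc_fps (of_real pi / 2) $ 0 \<noteq> 0" by (simp add: sinc_fps_def)
  ultimately have "fps_lim (\<lambda>M. inverse (Q' M)) (inverse (sinc_fps (of_real pi / 2)))"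
    by (rule fps_lim_inverse)
  moreover have "fps_lim (\<lambda>M. Q (2 * M)) (sinc_fps (of_real pi))"
    unfolding fps_lim_def
  proof
    fix n
    have "strict_mono (\<lambda>M::nat. 2 * M)" by (auto intro: strict_monoI)
    then show "(\<lambda>M. Q (2 * M) $ n) \<longlonglongrightarrow> sinc_fps (of_real pi) $ n"
      using LIMSEQ_subseq_LIMSEQ[OF Q[unfolded fps_lim_def, rule_format, of n]] by (simp add: o_def)
  qed
  ultimately have "fps_lim P (sinc_fps (of_real pi) * inverse (sinc_fps (of_real pi / 2)))"
    unfolding P by (intro fps_lim_mult)
  also have "sinc_fps (of_real pi) * inverse (sinc_fps (of_real pi / 2)) =
      cos_sqrt_fps (of_real pi / 2) * (sinc_fps (of_real pi / 2) * inverse (sinc_fps (of_real pi / 2)))"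
    using sinc_fps_double[of "of_real pi / 2"] by (simp add: mult.assoc)
  also have "\<dots> = cos_sqrt_fps (of_real pi / 2)"
    by (simp add: inverse_mult_eq_1'[OF nz])
  finally show ?thesis by (simp add: P_def u_def)
qed

text \<open>For \<open>Bullet\<close> the lower entries \<open>2 n_l + 1\<close> add up to
  \<open>2 n + k\<close>; for \<open>Star\<close> each of the \<open>k\<close> coefficients
  contributes \<open>(-1) ^ (n_l + 1)\<close>, hence the sign \<open>(-1) ^ (n + k)\<close>.\<close>

lemma prod_mode_inv_sinc_nth:
  assumes "c \<noteq> 0"
  shows "mode_inv \<omega> (\<Prod>l=1..k. sinc_fps c oo (fps_const (zeta_root k ^ l) * fps_X)) $ n =
    (case \<omega> of Bullet \<Rightarrow> (-1) ^ n / fact (2 * n + k) | Star \<Rightarrow> (-1) ^ (n + k) / fact (2 * n))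
      * c ^ (2 * n) * A_num_1 \<omega> k n"
proof -
  have nz: "sinc_fps c $ 0 \<noteq> 0" by (simp add: sinc_fps_def)
  have "mode_inv \<omega> (\<Prod>l=1..k. sinc_fps c oo (fps_const (zeta_root k ^ l) * fps_X)) $ n =
      (\<Prod>l=1..k. mode_inv \<omega> (sinc_fps c) oo (fps_const (zeta_root k ^ l * 1) * fps_X)) $ n"
    by (simp add: mode_inv_prod mode_inv_compose[OF nz])
  also have "\<dots> = (\<Sum>ns\<in>weak_comps k n.
      (\<Prod>l=1..k. mode_inv \<omega> (sinc_fps c) $ ns l) * zeta_root k ^ (\<Sum>l=1..k. l * ns l))"
    unfolding prod_compose_zeta_nth by simp
  also have "\<dots> = (case \<omega> of Bullet \<Rightarrow> (-1) ^ n / fact (2 * n + k) | Star \<Rightarrow> (-1) ^ (n + k) / fact (2 * n))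
      * c ^ (2 * n) * A_num_1 \<omega> k n"
    unfolding A_num_1_def sum_distrib_left
  proof (rule sum.cong[OF refl])
    fix ns assume "ns \<in> weak_comps k n"
    then have n: "(\<Sum>l=1..k. ns l) = n" by (simp add: weak_comps_def)
    have pw: "(\<Prod>l=1..k. x ^ ns l) = x ^ n" for x :: complex
      by (simp only: power_sum[symmetric] n)
    have two: "(\<Sum>l=1..k. 2 * ns l) = 2 * n" by (simp only: sum_distrib_left[symmetric] n)
    then have two': "(\<Sum>l=1..k. 2 * ns l + 1) = 2 * n + k" by (simp only: sum.distrib) simp
    show "(\<Prod>l=1..k. mode_inv \<omega> (sinc_fps c) $ ns l) * zeta_root k ^ (\<Sum>l=1..k. l * ns l) =
       (case \<omega> of Bullet \<Rightarrow> (-1) ^ n / fact (2 * n + k) | Star \<Rightarrow> (-1) ^ (n + k) / fact (2 * n))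
        * c ^ (2 * n) *
       ((case \<omega> of Bullet \<Rightarrow> multinom k (\<lambda>l. 2 * ns l + 1)
         | Star \<Rightarrow> multinom k (\<lambda>l. 2 * ns l) *
             (\<Prod>l=1..k. (2 ^ (2 * ns l) - 2) * bernoulli_num (2 * ns l)))
          * zeta_root k ^ (\<Sum>l=1..k. l * ns l))"
    proof (cases \<omega>)
      case Bullet
      have "(\<Prod>l=1..k. sinc_fps c $ ns l) = (\<Prod>l=1..k. ((-1) ^ ns l * (c ^ 2) ^ ns l) / fact (2 * ns l + 1))"
        unfolding sinc_fps_def by (simp only: power_mult[symmetric] fps_nth_Abs_fps)
      also have "\<dots> = (-1) ^ n * c ^ (2 * n) / (\<Prod>l=1..k. fact (2 * ns l + 1))"
        by (simp only: prod_dividef prod.distrib pw power_mult)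
      finally show ?thesis
        by (simp only: Bullet mode.case mode_inv_def multinom_def two') simp
    next
      case Star
      have "(\<Prod>l=1..k. inverse (sinc_fps c) $ ns l) =
          (\<Prod>l=1..k. (((-1) * ((-1) ^ ns l * (c ^ 2) ^ ns l)) * ((2 ^ (2 * ns l) - 2) * bernoulli_num (2 * ns l))) / fact (2 * ns l))"
        by (simp add: inverse_sinc_fps_nth[OF assms] power_mult mult.assoc)
      also have "\<dots> = ((-1) ^ k * ((-1) ^ n * c ^ (2 * n))) *
          (\<Prod>l=1..k. (2 ^ (2 * ns l) - 2) * bernoulli_num (2 * ns l)) / (\<Prod>l=1..k. fact (2 * ns l))"
        unfolding prod_dividef prod.distrib[of "\<lambda>l. (-1) * ((-1) ^ ns l * (c ^ 2) ^ ns l)"]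
          prod.distrib[of "\<lambda>l. -1"] prod.distrib[of "\<lambda>l. (-1) ^ ns l"] pw
        by (simp add: power_mult)
      finally show ?thesis
        by (simp only: Star mode.case mode_inv_def multinom_def two) (simp add: power_add)
    qed
  qed
  finally show ?thesis .
qed

lemma prod_mode_inv_cos_nth:
  "mode_inv \<omega> (\<Prod>l=1..k. cos_sqrt_fps c oo (fps_const (zeta_root k ^ l) * fps_X)) $ n =
    (-1) ^ n / fact (2 * n) * c ^ (2 * n) * A_num_2 \<omega> k n"
proof -
  have nz: "cos_sqrt_fps c $ 0 \<noteq> 0" by (simp add: cos_sqrt_fps_def)
  have coeff: "mode_inv \<omega> (cos_sqrt_fps c) $ n = (-1) ^ n * c ^ (2 * n) *
      (case \<omega> of Bullet \<Rightarrow> 1 | Star \<Rightarrow> euler_num (2 * n)) / fact (2 * n)" for n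
    by (cases \<omega>) (auto simp: mode_inv_def inverse_cos_sqrt_fps_nth, simp add: cos_sqrt_fps_def)
  have "mode_inv \<omega> (\<Prod>l=1..k. cos_sqrt_fps c oo (fps_const (zeta_root k ^ l) * fps_X)) $ n =
      (\<Prod>l=1..k. mode_inv \<omega> (cos_sqrt_fps c) oo (fps_const (zeta_root k ^ l * 1) * fps_X)) $ n"
    by (simp add: mode_inv_prod mode_inv_compose[OF nz])
  also have "\<dots> = (\<Sum>ns\<in>weak_comps k n.
      (\<Prod>l=1..k. mode_inv \<omega> (cos_sqrt_fps c) $ ns l) * zeta_root k ^ (\<Sum>l=1..k. l * ns l))"
    unfolding prod_compose_zeta_nth by simp
  also have "\<dots> = (-1) ^ n / fact (2 * n) * c ^ (2 * n) * A_num_2 \<omega> k n"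
    unfolding A_num_2_def sum_distrib_left
  proof (rule sum.cong[OF refl])
    fix ns assume "ns \<in> weak_comps k n"
    then have n: "(\<Sum>l=1..k. ns l) = n" by (simp add: weak_comps_def)
    have pw: "(\<Prod>l=1..k. x ^ ns l) = x ^ n" for x :: complex
      by (simp only: power_sum[symmetric] n)
    have two: "(\<Sum>l=1..k. 2 * ns l) = 2 * n" by (simp only: sum_distrib_left[symmetric] n)
    have E: "(\<Prod>l=1..k. case \<omega> of Bullet \<Rightarrow> 1 | Star \<Rightarrow> euler_num (2 * ns l)) =
        (case \<omega> of Bullet \<Rightarrow> 1 | Star \<Rightarrow> (\<Prod>l=1..k. euler_num (2 * ns l)))"
      by (cases \<omega>) auto
    have "(\<Prod>l=1..k. mode_inv \<omega> (cos_sqrt_fps c) $ ns l) = (-1) ^ n * c ^ (2 * n) *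
        (case \<omega> of Bullet \<Rightarrow> 1 | Star \<Rightarrow> (\<Prod>l=1..k. euler_num (2 * ns l))) / (\<Prod>l=1..k. fact (2 * ns l))"
      by (simp only: coeff prod_dividef prod.distrib pw power_mult E)
    then show "(\<Prod>l=1..k. mode_inv \<omega> (cos_sqrt_fps c) $ ns l) * zeta_root k ^ (\<Sum>l=1..k. l * ns l) =
       (-1) ^ n / fact (2 * n) * c ^ (2 * n) * (multinom k (\<lambda>l. 2 * ns l) *
         (case \<omega> of Bullet \<Rightarrow> 1 | Star \<Rightarrow> (\<Prod>l=1..k. euler_num (2 * ns l)))
          * zeta_root k ^ (\<Sum>l=1..k. l * ns l))"
      by (simp only: multinom_def two) simp
  qed
  finally show ?thesis .
qed

text \<open>Each factor splits over the \<open>k\<close>-th roots of unity; exchanging the two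
  products leaves \<open>k\<close> rescaled copies of the partial product whose limit is
  known.\<close>

lemma fps_lim_power_partial_product:
  assumes k: "k \<ge> 1" and lim: "fps_lim (\<lambda>R. \<Prod>m=1..R. 1 - fps_const (c m) * fps_X) F"
  shows "fps_lim (\<lambda>R. \<Prod>m=1..R. 1 - fps_const (c m ^ k) * fps_X ^ k)
           (\<Prod>l=1..k. F oo (fps_const (zeta_root k ^ l) * fps_X))"
proof -
  have "(\<Prod>m=1..R. 1 - fps_const (c m ^ k) * fps_X ^ k) =
        (\<Prod>l=1..k. (\<Prod>m=1..R. 1 - fps_const (c m) * fps_X) oo (fps_const (zeta_root k ^ l) * fps_X))" for R
  proof -
    have "(\<Prod>m=1..R. 1 - fps_const (c m ^ k) * fps_X ^ k) =
        (\<Prod>m=1..R. \<Prod>l=1..k. 1 - fps_const (zeta_root k ^ l * c m) * fps_X)"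
      by (simp only: prod_zeta_root_fps[OF k])
    also have "\<dots> = (\<Prod>l=1..k. \<Prod>m=1..R. 1 - fps_const (c m * zeta_root k ^ l) * fps_X)"
      by (subst prod.swap) (simp only: mult.commute)
    also have "\<dots> = (\<Prod>l=1..k. (\<Prod>m=1..R. 1 - fps_const (c m) * fps_X) oo (fps_const (zeta_root k ^ l) * fps_X))"
      by (simp add: fps_compose_prod_distrib fps_compose_sub_distrib fps_compose_mult_distrib flip: mult.assoc)
    finally show ?thesis .
  qed
  moreover have "fps_lim (\<lambda>R. \<Prod>l=1..k. (\<Prod>m=1..R. 1 - fps_const (c m) * fps_X) oo (fps_const (zeta_root k ^ l) * fps_X))
           (\<Prod>l=1..k. F oo (fps_const (zeta_root k ^ l) * fps_X))"
    by (intro fps_lim_prod fps_lim_compose_linear lim)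
  ultimately show ?thesis by simp
qed

section \<open>Limits of the truncated sums for moduli 1 and 2\<close>

lemma tendsto_inverse_power: "p \<ge> 1 \<Longrightarrow> (\<lambda>m. 1 / of_nat m ^ p :: complex) \<longlonglongrightarrow> 0"
  using tendsto_power[OF lim_1_over_n[where 'a = complex], of p] by (simp add: power_divide power_0_left)

text \<open>For \<open>Star\<close> the exponent \<open>k (d - 1)\<close> is replaced by
  \<open>k d + k\<close>, which has the same parity and is a natural number even for
  \<open>d = 0\<close>.\<close>

lemma C_num_mod_1:
  "C_num \<omega> 1 d (2 * k) = of_int (eps \<omega>) ^ d *
     (case \<omega> of Bullet \<Rightarrow> (-1) ^ (k * d) / fact (2 * (k * d) + k)
      | Star \<Rightarrow> (-1) ^ (k * d + k) / fact (2 * (k * d)))"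
proof (cases \<omega>)
  case Bullet
  have "nat ((2 * int d + 1 - 0) * int k) = 2 * (k * d) + k"
    by (simp add: algebra_simps nat_eq_iff)
  moreover have "(-1 :: real) powi (int k * (int d - 0)) = (-1) ^ (k * d)"
    by (simp flip: of_nat_mult)
  ultimately show ?thesis by (simp add: Bullet C_num_def Let_def eps_tilde_def)
next
  case Star
  have "nat ((2 * int d + 1 - 1) * int k) = 2 * (k * d)"
    by (simp add: algebra_simps nat_eq_iff)
  moreover have "(-1 :: real) powi (int k * (int d - 1)) = (-1) ^ (k * d + k)"
  proof -
    have "(-1 :: real) powi (int k * (int d - 1)) = (-1) powi (int (k * d) - int k)"
      by (simp add: algebra_simps)
    also have "\<dots> = (-1) ^ (k * d) / (-1) ^ k"
      by (subst power_int_diff) (auto simp flip: of_nat_mult)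
    also have "\<dots> = (-1) ^ (k * d + k)"
      by (simp add: power_add minus_one_power_iff)
    finally show ?thesis .
  qed
  ultimately show ?thesis by (simp add: Star C_num_def Let_def eps_tilde_def)
qed

text \<open>In terms of the squared variable the exponent is \<open>k\<close> rather than
  \<open>2 k\<close>, which is why \<open>A_num_1\<close> is taken at \<open>k * d\<close>.\<close>

lemma mult_sum_mod_1:
  assumes k: "k \<ge> 1"
  shows "(\<lambda>M. mult_sum \<omega> (\<lambda>m. 1 / of_nat m ^ (2 * k)) d M) \<longlonglongrightarrow>
           of_real (C_num \<omega> 1 d (2 * k)) * A_num_1 \<omega> k (k * d) * of_real pi ^ (2 * k * d)"
    and "\<not> k dvd n \<Longrightarrow> A_num_1 \<omega> k n = 0"
proof -
  define G where "G = (\<Prod>l=1..k. sinc_fps (of_real pi) oo (fps_const (zeta_root k ^ l) * fps_X))"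
  have "fps_lim (\<lambda>R. \<Prod>m=1..R. 1 - fps_const ((1 / of_nat m ^ 2) ^ k) * fps_X ^ k) G"
    unfolding G_def by (rule fps_lim_power_partial_product[OF k fps_lim_sinc])
  then have lim: "fps_lim (\<lambda>R. \<Prod>m=1..1 * R + 0. 1 - fps_const (1 / of_nat m ^ (2 * k)) * fps_X ^ k) G"
    by (simp add: power_divide power_mult)
  have a: "(\<lambda>m. 1 / of_nat m ^ (2 * k) :: complex) \<longlonglongrightarrow> 0"
    using k by (intro tendsto_inverse_power) auto
  have nth: "mode_inv \<omega> G $ n = (case \<omega> of Bullet \<Rightarrow> (-1) ^ n / fact (2 * n + k) | Star \<Rightarrow> (-1) ^ (n + k) / fact (2 * n))
      * of_real pi ^ (2 * n) * A_num_1 \<omega> k n" for n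
    unfolding G_def by (rule prod_mode_inv_sinc_nth) simp
  have "(\<lambda>M. mult_sum \<omega> (\<lambda>m. 1 / of_nat m ^ (2 * k)) d M) \<longlonglongrightarrow> of_int (eps \<omega>) ^ d * mode_inv \<omega> G $ (k * d)"
    by (rule mult_sum_tendsto[OF a _ k lim]) simp
  also have "of_int (eps \<omega>) ^ d * mode_inv \<omega> G $ (k * d) =
      of_real (C_num \<omega> 1 d (2 * k)) * A_num_1 \<omega> k (k * d) * of_real pi ^ (2 * k * d)"
    unfolding nth C_num_mod_1 by (cases \<omega>) (simp_all add: mult.assoc)
  finally show "(\<lambda>M. mult_sum \<omega> (\<lambda>m. 1 / of_nat m ^ (2 * k)) d M) \<longlonglongrightarrow>
           of_real (C_num \<omega> 1 d (2 * k)) * A_num_1 \<omega> k (k * d) * of_real pi ^ (2 * k * d)" .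
  show "A_num_1 \<omega> k n = 0" if "\<not> k dvd n"
  proof -
    have "mode_inv \<omega> G $ n = 0"
      by (rule mode_inv_nth_eq_0[OF a _ k lim that]) simp
    then show ?thesis by (simp add: nth split: mode.splits)
  qed
qed

lemma mult_sum_mod_2:
  assumes k: "k \<ge> 1"
  shows "(\<lambda>M. mult_sum \<omega> (\<lambda>m. (if even m then 0 else 1) / of_nat m ^ (2 * k)) d M) \<longlonglongrightarrow>
           of_real (C_num \<omega> 2 d (2 * k)) * A_num_2 \<omega> k (k * d) * of_real pi ^ (2 * k * d)"
    and "\<not> k dvd n \<Longrightarrow> A_num_2 \<omega> k n = 0"
proof -
  define G where "G = (\<Prod>l=1..k. cos_sqrt_fps (of_real pi / 2) oo (fps_const (zeta_root k ^ l) * fps_X))"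
  define a where "a = (\<lambda>m. (if even m then 0 else 1) / of_nat m ^ (2 * k) :: complex)"
  \<comment> \<open>Even indices give factors 1, so the products of length \<open>2 R\<close> run
    over odd indices; \<open>mult_sum_tendsto\<close> takes care of the odd lengths.\<close>
  have "(\<Prod>m=1..2 * R. 1 - fps_const (a m) * fps_X ^ k) =
      (\<Prod>m=1..R. 1 - fps_const ((1 / of_nat (2 * m - 1) ^ 2) ^ k) * fps_X ^ k)" for R
    by (induction R) (simp_all add: a_def power_divide power_mult)
  moreover have "fps_lim (\<lambda>R. \<Prod>m=1..R. 1 - fps_const ((1 / of_nat (2 * m - 1) ^ 2) ^ k) * fps_X ^ k) G"
    unfolding G_def by (rule fps_lim_power_partial_product[OF k fps_lim_cos_sqrt])
  ultimately have lim: "fps_lim (\<lambda>R. \<Prod>m=1..2 * R + 0. 1 - fps_const (a m) * fps_X ^ k) G"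
    by simp
  have "(\<lambda>m. 1 / of_nat m ^ (2 * k) :: complex) \<longlonglongrightarrow> 0"
    using k by (intro tendsto_inverse_power) auto
  then have a: "a \<longlonglongrightarrow> 0"
    by (rule Lim_null_comparison[rotated, OF tendsto_norm_zero]) (auto simp: a_def)
  have nth: "mode_inv \<omega> G $ n = (-1) ^ n / fact (2 * n) * (of_real pi / 2) ^ (2 * n) * A_num_2 \<omega> k n" for n
    unfolding G_def by (rule prod_mode_inv_cos_nth)
  have "(\<lambda>M. mult_sum \<omega> a d M) \<longlonglongrightarrow> of_int (eps \<omega>) ^ d * mode_inv \<omega> G $ (k * d)"
    by (rule mult_sum_tendsto[OF a _ k lim]) simp
  also have "of_int (eps \<omega>) ^ d * mode_inv \<omega> G $ (k * d) =
      of_real (C_num \<omega> 2 d (2 * k)) * A_num_2 \<omega> k (k * d) * of_real pi ^ (2 * k * d)"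
    by (simp add: nth C_num_def power_divide mult_ac)
  finally show "(\<lambda>M. mult_sum \<omega> (\<lambda>m. (if even m then 0 else 1) / of_nat m ^ (2 * k)) d M) \<longlonglongrightarrow>
           of_real (C_num \<omega> 2 d (2 * k)) * A_num_2 \<omega> k (k * d) * of_real pi ^ (2 * k * d)"
    by (simp only: a_def)
  show "A_num_2 \<omega> k n = 0" if "\<not> k dvd n"
  proof -
    have "mode_inv \<omega> G $ n = 0"
      by (rule mode_inv_nth_eq_0[OF a _ k lim that]) simp
    then show ?thesis by (simp add: nth)
  qed
qed

section \<open>Moduli at least 3\<close>

text \<open>The partial products of \<open>sin (\<pi> (a + x)) / sin (\<pi> a)\<close>.\<close>
definition sin_block :: "complex \<Rightarrow> nat \<Rightarrow> complex fps" where
  "sin_block a n = (1 + fps_const (1 / a) * fps_X) *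
     (\<Prod>k=1..n. (1 + fps_const (1 / (a - of_nat k)) * fps_X) * (1 + fps_const (1 / (a + of_nat k)) * fps_X))"

lemma fps_const_mult_one_plus_X: "a \<noteq> 0 \<Longrightarrow> fps_const a * (1 + fps_const (1 / a) * fps_X) = fps_const (a::complex) + fps_X"
  by (simp add: distrib_left flip: mult.assoc)

text \<open>\<open>sin_block a n\<close> is \<open>sin_product_fps a n\<close> divided by its
  constant term, which tends to the nonzero number \<open>sin (pi a)\<close>.\<close>

lemma fps_lim_sin_block:
  assumes a: "sin (of_real pi * a) \<noteq> 0"
  shows "fps_lim (sin_block a) (fps_const (1 / sin (of_real pi * a)) * sin_fps (of_real pi * a) (of_real pi))"
proof -
  have "a \<noteq> of_int k" for k
    using a sin_eq_0[of "of_real pi * a"] by (auto simp: mult.commute)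
  from this[of 0] this[of "int k" for k] this[of "- int k" for k]
  have nz: "a \<noteq> 0" "a - of_nat k \<noteq> 0" "a + of_nat k \<noteq> 0" for k
    by (auto simp: add_eq_0_iff2)
  define s where "s = (\<lambda>n. of_real pi * a * (\<Prod>k=1..n. 1 - a^2 / of_nat k^2))"
  \<comment> \<open>Factor \<open>k^2 - (a + X)^2\<close> as a difference of squares and normalise
    both linear factors to constant term 1.\<close>
  have factor: "1 - (fps_const a + fps_X)^2 * fps_const (1 / of_nat k^2) = fps_const (1 - a^2 / of_nat k^2) *
      ((1 + fps_const (1 / (a - of_nat k)) * fps_X) * (1 + fps_const (1 / (a + of_nat k)) * fps_X))"
    if "k \<ge> 1" for k :: nat
  proof -
    have "1 - a^2 / of_nat k^2 = - (1 / of_nat k ^ 2) * ((a - of_nat k) * (a + of_nat k))"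
      using that by (simp add: field_simps power2_eq_square)
    then have "fps_const (1 - a^2 / of_nat k^2) *
        ((1 + fps_const (1 / (a - of_nat k)) * fps_X) * (1 + fps_const (1 / (a + of_nat k)) * fps_X)) =
      fps_const (- (1 / of_nat k ^ 2)) * ((fps_const (a - of_nat k) * (1 + fps_const (1 / (a - of_nat k)) * fps_X)) *
        (fps_const (a + of_nat k) * (1 + fps_const (1 / (a + of_nat k)) * fps_X)))"
      by (simp only: fps_const_mult[symmetric] mult_ac)
    also have "\<dots> = fps_const (- (1 / of_nat k ^ 2)) * ((fps_const a + fps_X)^2 - fps_const (of_nat k ^ 2))"
      unfolding fps_const_mult_one_plus_X[OF nz(2)] fps_const_mult_one_plus_X[OF nz(3)]
      by (simp add: power2_eq_square algebra_simps flip: fps_const_add fps_const_sub fps_const_mult)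
    also have "\<dots> = 1 - (fps_const a + fps_X)^2 * fps_const (1 / of_nat k^2)"
      using that by (simp add: right_diff_distrib flip: fps_const_neg)
    finally show ?thesis ..
  qed
  have "sin_product_fps a n = fps_const (s n) * sin_block a n" for n
  proof -
    have "(\<Prod>k=1..n. 1 - (fps_const a + fps_X)^2 * fps_const (1 / of_nat k^2)) =
        (\<Prod>k=1..n. fps_const (1 - a^2 / of_nat k^2)) * (\<Prod>k=1..n.
          ((1 + fps_const (1 / (a - of_nat k)) * fps_X) * (1 + fps_const (1 / (a + of_nat k)) * fps_X)))"
      unfolding prod.distrib[symmetric] by (intro prod.cong refl factor) auto
    also have "(\<Prod>k=1..n. fps_const (1 - a^2 / of_nat k^2)) = fps_const (\<Prod>k=1..n. 1 - a^2 / of_nat k^2)"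
      by (rule prod_fps_const)
    finally show ?thesis
      unfolding sin_product_fps_def sin_block_def s_def fps_const_mult_one_plus_X[OF nz(1), symmetric]
      by (simp only: fps_const_mult[symmetric] mult_ac)
  qed
  moreover have s_nz: "s n \<noteq> 0" for n
  proof -
    have sq: "a^2 \<noteq> of_nat k^2" for k
      using nz(2)[of k] nz(3)[of k] by (auto simp: power2_eq_iff eq_neg_iff_add_eq_0)
    have "1 - a^2 / of_nat k^2 \<noteq> 0" if "k \<ge> 1" for k :: nat
      using that sq[of k] by (auto simp: field_simps)
    then show ?thesis using nz(1) by (auto simp: s_def)
  qed
  ultimately have block: "sin_block a = (\<lambda>n. fps_const (1 / s n) * sin_product_fps a n)"
    by (auto simp: fun_eq_iff mult.assoc[symmetric])
  have "s \<longlonglongrightarrow> sin (of_real pi * a)"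
    unfolding s_def by (rule sin_product_formula_complex)
  then have "(\<lambda>n. 1 / s n) \<longlonglongrightarrow> 1 / sin (of_real pi * a)"
    using a by (intro tendsto_divide) auto
  then show ?thesis
    unfolding block by (intro fps_lim_mult fps_lim_fps_const fps_lim_sin_product)
qed

lemma sin_block_compose:
  "sin_block a n oo (fps_const z * fps_X) = (1 + fps_const (z * (1 / a)) * fps_X) *
     (\<Prod>k=1..n. (1 + fps_const (z * (1 / (a - of_nat k))) * fps_X) *
                 (1 + fps_const (z * (1 / (a + of_nat k))) * fps_X))"
proof -
  have "(1 + fps_const x * fps_X) oo (fps_const z * fps_X) = 1 + fps_const (z * x) * fps_X" for x
    by (simp add: fps_compose_add_distrib fps_compose_mult_distrib mult.commute[of z] flip: mult.assoc)
  then show ?thesis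
    by (simp add: sin_block_def fps_compose_mult_distrib fps_compose_prod_distrib)
qed

text \<open>Multiplying each linear factor over its copies rescaled by roots of unity gives a factor
  in \<open>X^\<kappa>\<close>; the sign in \<open>- z\<close> comes from the plus signs in the
  block.\<close>

lemma prod_sin_block_compose:
  assumes "\<kappa> \<ge> 1"
  shows "(\<Prod>l=1..\<kappa>. sin_block a n oo (fps_const (zeta_root \<kappa> ^ l * z) * fps_X)) =
    (1 - fps_const ((- z / a) ^ \<kappa>) * fps_X ^ \<kappa>) *
     (\<Prod>k=1..n. (1 - fps_const ((- z / (a - of_nat k)) ^ \<kappa>) * fps_X ^ \<kappa>) *
                 (1 - fps_const ((- z / (a + of_nat k)) ^ \<kappa>) * fps_X ^ \<kappa>))"
proof -
  have *: "(\<Prod>l=1..\<kappa>. 1 + fps_const (zeta_root \<kappa> ^ l * z * (1 / x)) * fps_X) =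
      1 - fps_const ((- z / x) ^ \<kappa>) * fps_X ^ \<kappa>" for x
    unfolding prod_zeta_root_fps[OF assms, symmetric] by (simp flip: fps_const_neg)
  have **: "(\<Prod>l=1..\<kappa>. \<Prod>k=1..n. 1 + fps_const (zeta_root \<kappa> ^ l * z * (1 / g k)) * fps_X) =
      (\<Prod>k=1..n. 1 - fps_const ((- z / g k) ^ \<kappa>) * fps_X ^ \<kappa>)" for g
    by (subst prod.swap) (simp only: *)
  show ?thesis
    by (simp only: sin_block_compose prod.distrib * **)
qed

text \<open>
  The indices missed by the blocks are the multiples of \<open>N\<close> and, for even \<open>N\<close>, the odd multiples of
  \<open>N / 2\<close>; they are not coprime to \<open>N\<close>.
\<close>
lemma prod_symmetric_blocks:
  fixes f :: "nat \<Rightarrow> 'a :: comm_monoid_mult"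
  assumes N: "N \<ge> 3" and f: "\<And>m. \<not> coprime m N \<Longrightarrow> f m = 1"
  defines "h \<equiv> (N - 1) div 2"
  shows "(\<Prod>m=1..N * R + h. f m) = (\<Prod>j=1..h. f j * (\<Prod>k=1..R. f (k * N - j) * f (k * N + j)))"
proof (induction R)
  case 0
  then show ?case by simp
next
  case (Suc R)
  \<comment> \<open>\<open>L\<close> is the next multiple of \<open>N\<close>. The new
    \<open>N\<close> indices are \<open>L - h, ..., L + h\<close> and, for even \<open>N\<close>,
    also \<open>L - N / 2\<close>.\<close>
  define L where "L = Suc R * N"
  have h: "h < N" "2 * h + 1 = N \<or> 2 * h + 2 = N" using N by (auto simp: h_def)
  have L: "L = N * R + N" by (simp add: L_def)
  have "prod f {N * R + h + 1..L + h} = prod f ((\<lambda>j. L - j) ` {1..h} \<union> (\<lambda>j. L + j) ` {1..h})"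
  proof (rule prod.mono_neutral_right)
    show "(\<lambda>j. L - j) ` {1..h} \<union> (\<lambda>j. L + j) ` {1..h} \<subseteq> {N * R + h + 1..L + h}"
      using h by (auto simp: L)
    show "\<forall>m\<in>{N * R + h + 1..L + h} - ((\<lambda>j. L - j) ` {1..h} \<union> (\<lambda>j. L + j) ` {1..h}). f m = 1"
    proof
      fix m assume m: "m \<in> {N * R + h + 1..L + h} - ((\<lambda>j. L - j) ` {1..h} \<union> (\<lambda>j. L + j) ` {1..h})"
      have "m \<le> L"
      proof (rule ccontr)
        assume "\<not> m \<le> L"
        then have "m = L + (m - L)" "m - L \<in> {1..h}" using m by auto
        then show False using m by blast
      qed
      have "m + h < L \<or> m = L"
      proof (rule ccontr)
        assume "\<not> (m + h < L \<or> m = L)"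
        then have "m = L - (L - m)" "L - m \<in> {1..h}" using \<open>m \<le> L\<close> by auto
        then show False using m by blast
      qed
      then consider "m = L" | "2 * h + 2 = N" "m = N * R + h + 1"
        using m h \<open>m \<le> L\<close> by (auto simp: L)
      then have "\<exists>g>1. g dvd m \<and> g dvd N"
      proof cases
        case 1
        then show ?thesis using N by (intro exI[of _ N]) (auto simp: L)
      next
        case 2
        then have "N = (h + 1) * 2" "m = (h + 1) * (2 * R + 1)" by (auto simp: algebra_simps)
        moreover have "h + 1 > 1" using 2 N by auto
        ultimately show ?thesis by (metis dvd_triv_left)
      qed
      then have "\<not> coprime m N" by (metis coprime_common_divisor_nat less_irrefl)
      then show "f m = 1" by (rule f)
    qed
  qed auto
  also have "\<dots> = prod f ((\<lambda>j. L - j) ` {1..h}) * prod f ((\<lambda>j. L + j) ` {1..h})"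
    using h by (intro prod.union_disjoint) (auto simp: L)
  also have "prod f ((\<lambda>j. L - j) ` {1..h}) = (\<Prod>j=1..h. f (L - j))"
    using h by (subst prod.reindex) (auto simp: L inj_on_def)
  also have "prod f ((\<lambda>j. L + j) ` {1..h}) = (\<Prod>j=1..h. f (L + j))"
    by (subst prod.reindex) (auto simp: inj_on_def)
  finally have block: "prod f {N * R + h + 1..L + h} = (\<Prod>j=1..h. f (L - j) * f (L + j))"
    by (simp add: prod.distrib)
  have "{1..N * Suc R + h} = {1..N * R + h} \<union> {N * R + h + 1..L + h}"
    by (auto simp: L)
  then have "prod f {1..N * Suc R + h} = prod f {1..N * R + h} * prod f {N * R + h + 1..L + h}"
    by (simp add: prod.union_disjoint)
  then show ?case
    unfolding Suc block by (simp add: prod.distrib L_def mult_ac)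
qed

lemma princ_root_power:
  assumes "k \<ge> 1"
  shows "princ_root k z ^ k = z"
proof -
  have "princ_root k z ^ k = of_real (root k (norm z) ^ k) * cis (Arg2pi z / real k) ^ k"
    by (simp add: princ_root_def power_mult_distrib)
  also have "\<dots> = of_real (norm z) * cis (Arg2pi z)"
    using assms by (simp add: Complex.DeMoivre)
  also have "\<dots> = z" using Arg2pi_eq[of z] by (simp add: cis_conv_exp)
  finally show ?thesis .
qed

text \<open>Uniqueness of Taylor coefficients identifies the analytically defined
  \<open>T_num\<close> with the coefficients of the formal sine series or of its formal
  inverse.\<close>

lemma mode_inv_sin_fps_nth:
  assumes "sin a \<noteq> 0"
  shows "mode_inv \<omega> (sin_fps a 1) $ n = T_num \<omega> a n / fact n"
proof -
  have sin: "(\<lambda>t. sin (a + t)) has_fps_expansion sin_fps a 1"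
    using has_fps_expansion_sin_fps[of a 1] by simp
  have "(\<lambda>t. trig_fun \<omega> (a + t)) has_fps_expansion mode_inv \<omega> (sin_fps a 1)"
  proof (cases \<omega>)
    case Bullet
    then show ?thesis using sin by (simp add: mode_inv_def)
  next
    case Star
    have "(\<lambda>t. inverse (sin (a + t))) has_fps_expansion inverse (sin_fps a 1)"
      using assms by (intro has_fps_expansion_inverse sin) (auto simp: sin_fps_def)
    then show ?thesis by (simp add: mode_inv_def Star inverse_eq_divide)
  qed
  then show ?thesis
    by (simp add: fps_nth_fps_expansion T_num_def fps_expansion_def)
qed

section \<open>Periodicity and boundedness of Dirichlet characters\<close>

lemma dirichlet_character_mod:
  assumes "dirichlet_character N chi"
  shows "chi (int m) = chi (int (m mod N))"
proof -
  have "chi (int (m mod N + N * q)) = chi (int (m mod N))" for q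
  proof (induction q)
    case (Suc q)
    have "chi (int (m mod N + N * Suc q)) = chi (int (m mod N + N * q) + int N)"
      by (simp add: algebra_simps)
    also have "\<dots> = chi (int (m mod N + N * q))"
      using assms unfolding dirichlet_character_def by blast
    finally show ?case using Suc by simp
  qed simp
  from this[of "m div N"] show ?thesis by simp
qed

lemma dirichlet_character_add_multiple:
  assumes "dirichlet_character N chi"
  shows "chi (a + int k * int N) = chi a"
proof (induction k)
  case (Suc k)
  have "chi (a + int (Suc k) * int N) = chi (a + int k * int N + int N)"
    by (simp add: algebra_simps)
  also have "\<dots> = chi (a + int k * int N)"
    using assms unfolding dirichlet_character_def by blast
  finally show ?case using Suc by simp
qed simp

lemma dirichlet_character_over_power_tendsto_0:
  assumes "dirichlet_character N chi" "\<kappa> \<ge> 1"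
  shows "(\<lambda>m. chi (int m) / of_nat m ^ \<kappa>) \<longlonglongrightarrow> 0"
proof -
  define B where "B = Max ((\<lambda>m. norm (chi (int m))) ` {..<N})"
  have "N \<ge> 1" using assms(1) by (simp add: dirichlet_character_def)
  then have B: "norm (chi (int m)) \<le> B" for m
    unfolding B_def by (subst dirichlet_character_mod[OF assms(1)]) (auto intro!: Max_ge)
  have "(\<lambda>m. B * norm (1 / of_nat m ^ \<kappa> :: complex)) \<longlonglongrightarrow> B * norm (0::complex)"
    by (intro tendsto_intros tendsto_norm tendsto_inverse_power assms(2))
  then have "(\<lambda>m. B * norm (1 / of_nat m ^ \<kappa> :: complex)) \<longlonglongrightarrow> 0" by simp
  then show ?thesis
    by (rule Lim_null_comparison[rotated]) 
       (auto intro!: always_eventually mult_right_mono B simp: norm_divide norm_power divide_inverse norm_inverse norm_mult)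
qed

text \<open>By \<open>prod_sin_half\<close> the base of the power \<open>\<kappa> / 2\<close> is the
  square of \<open>N^d s\<close> or of \<open>N^d / s\<close>, and positivity of \<open>s\<close>
  selects the root. The powers of \<open>s\<close> match the normalisation of the sine
  blocks.\<close>

lemma C_num_mod_ge3:
  assumes N: "N \<ge> 3"
  defines "s \<equiv> (\<Prod>j=1..(N - 1) div 2. sin (pi * real j / real N))"
  shows "C_num \<omega> N d \<kappa> = of_int (eps \<omega>) ^ d *
     ((case \<omega> of Bullet \<Rightarrow> 1 / s | Star \<Rightarrow> s) ^ \<kappa> * (-1 / real N) ^ (\<kappa> * d) / fact (\<kappa> * d))"
proof -
  have s2: "s ^ 2 = real N / 2 ^ (N - 1)" using N unfolding s_def by (intro prod_sin_half) auto
  have s: "s > 0"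
    unfolding s_def by (intro prod_pos sin_gt_zero) (auto simp: field_simps)
  define t where "t = (case \<omega> of Bullet \<Rightarrow> s | Star \<Rightarrow> 1 / s)"
  have t: "t > 0" using s by (cases \<omega>) (auto simp: t_def)
  have "real N powi (2 * int d - eps \<omega>) * 2 powi ((int N - 1) * eps \<omega>) = (real N ^ d * t) ^ 2"
  proof -
    have "real N powi (2 * int d - eps \<omega>) = real N ^ (2 * d) * real N powi (- eps \<omega>)"
    proof -
      have "real N powi (2 * int d - eps \<omega>) = real N powi (int (2 * d) + - eps \<omega>)" by simp
      also have "\<dots> = real N powi int (2 * d) * real N powi (- eps \<omega>)"
        using N by (intro power_int_add) auto
      finally show ?thesis by (simp only: power_int_of_nat)
    qed
    moreover have "(2 :: real) powi ((int N - 1) * eps \<omega>) = (2 ^ (N - 1)) powi (eps \<omega>)"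
    proof -
      have "int N - 1 = int (N - 1)" using N by simp
      then show ?thesis by (simp only: power_int_mult power_int_of_nat)
    qed
    moreover have "real N powi (- eps \<omega>) * (2 ^ (N - 1)) powi (eps \<omega>) = t ^ 2"
      using s2 s N by (cases \<omega>) (auto simp: t_def power_int_minus power_divide field_simps)
    ultimately show ?thesis by (simp add: power_mult_distrib power_mult[symmetric] mult.commute[of d] mult.assoc)
  qed
  moreover have "((real N ^ d * t) ^ 2) powr (real \<kappa> / 2) = (real N ^ d * t) ^ \<kappa>"
  proof -
    have pos: "real N ^ d * t > 0" using t N by simp
    then have "((real N ^ d * t) ^ 2) powr (real \<kappa> / 2) = ((real N ^ d * t) powr 2) powr (real \<kappa> / 2)"
      by simp
    also have "\<dots> = (real N ^ d * t) powr real \<kappa>" by (simp add: powr_powr)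
    also have "\<dots> = (real N ^ d * t) ^ \<kappa>" by (rule powr_realpow[OF pos])
    finally show ?thesis .
  qed
  ultimately have "C_num \<omega> N d \<kappa> = of_int (eps \<omega>) ^ d * (-1) ^ (\<kappa> * d) / ((real N ^ d * t) ^ \<kappa> * fact (\<kappa> * d))"
    using N by (simp add: C_num_def)
  also have "\<dots> = of_int (eps \<omega>) ^ d *
     ((case \<omega> of Bullet \<Rightarrow> 1 / s | Star \<Rightarrow> s) ^ \<kappa> * (-1 / real N) ^ (\<kappa> * d) / fact (\<kappa> * d))"
  proof -
    have 1: "(-1 / real N) ^ (\<kappa> * d) = (-1) ^ (\<kappa> * d) / real N ^ (\<kappa> * d)"
      by (simp only: power_divide)
    have 2: "(real N ^ d * t) ^ \<kappa> = real N ^ (\<kappa> * d) * t ^ \<kappa>"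
      by (simp add: power_mult_distrib mult.commute flip: power_mult)
    show ?thesis
      unfolding 1 2 by (cases \<omega>) (simp_all add: t_def power_divide mult_ac)
  qed
  finally show ?thesis .
qed

text \<open>The inner product over \<open>l\<close> produces \<open>A_num_j\<close>, the outer one
  over \<open>j\<close> the sum defining \<open>A_num_ge3\<close>; the factorials combine into
  multinomial coefficients.\<close>

lemma prod_A_num_j_nth:
  fixes c :: "nat \<Rightarrow> complex" and x :: complex
  assumes N: "N \<ge> 1"
  defines "h \<equiv> (N - 1) div 2" and "\<theta> \<equiv> (\<lambda>j. of_real (pi * real j / real N))"
  shows "(\<Prod>j=1..h. \<Prod>l=1..\<kappa>. mode_inv \<omega> (sin_fps (\<theta> j) 1) oo
            (fps_const (zeta_root \<kappa> ^ l * (x * c j)) * fps_X)) $ n =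
    x ^ n / fact n * (\<Sum>ns\<in>weak_comps h n. multinom h ns *
       (\<Prod>j=1..h. A_num_j \<omega> N j \<kappa> (ns j) * c j ^ ns j))"
proof -
  have inner: "(\<Prod>l=1..\<kappa>. mode_inv \<omega> (sin_fps (\<theta> j) 1) oo
      (fps_const (zeta_root \<kappa> ^ l * (x * c j)) * fps_X)) $ n =
    x ^ n * (A_num_j \<omega> N j \<kappa> n * c j ^ n) / fact n" if j: "j \<in> {1..h}" for j n
  proof -
    have "sin (pi * real j / real N) > 0"
      using j N by (intro sin_gt_zero) (auto simp: h_def field_simps)
    then have nz: "sin (\<theta> j) \<noteq> 0" unfolding \<theta>_def by (simp only: sin_of_real of_real_eq_0_iff)
    have "(\<Sum>ns\<in>weak_comps \<kappa> n. (\<Prod>l=1..\<kappa>. mode_inv \<omega> (sin_fps (\<theta> j) 1) $ ns l) *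
        zeta_root \<kappa> ^ (\<Sum>l=1..\<kappa>. l * ns l)) = A_num_j \<omega> N j \<kappa> n / fact n"
      unfolding A_num_j_def sum_divide_distrib
    proof (rule sum.cong[OF refl])
      fix ns assume "ns \<in> weak_comps \<kappa> n"
      then have n: "(\<Sum>l=1..\<kappa>. ns l) = n" by (simp add: weak_comps_def)
      show "(\<Prod>l=1..\<kappa>. mode_inv \<omega> (sin_fps (\<theta> j) 1) $ ns l) * zeta_root \<kappa> ^ (\<Sum>l=1..\<kappa>. l * ns l) =
         multinom \<kappa> ns * (\<Prod>l=1..\<kappa>. T_num \<omega> (of_real (pi * real j / real N)) (ns l)) *
         zeta_root \<kappa> ^ (\<Sum>l=1..\<kappa>. l * ns l) / fact n"
        unfolding mode_inv_sin_fps_nth[OF nz] prod_dividef multinom_def n by (simp add: \<theta>_def)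
    qed
    then show ?thesis unfolding prod_compose_zeta_nth by (simp add: power_mult_distrib)
  qed
  show ?thesis
    unfolding fps_prod_nth_weak_comps[of _ h] sum_distrib_left
  proof (rule sum.cong[OF refl])
    fix ns assume "ns \<in> weak_comps h n"
    then have n: "(\<Sum>j=1..h. ns j) = n" by (simp add: weak_comps_def)
    have "(\<Prod>j=1..h. (\<Prod>l=1..\<kappa>. mode_inv \<omega> (sin_fps (\<theta> j) 1) oo
        (fps_const (zeta_root \<kappa> ^ l * (x * c j)) * fps_X)) $ ns j) =
      (\<Prod>j=1..h. x ^ ns j * (A_num_j \<omega> N j \<kappa> (ns j) * c j ^ ns j) / fact (ns j))"
      by (intro prod.cong refl inner)
    also have "\<dots> = x ^ n * (\<Prod>j=1..h. A_num_j \<omega> N j \<kappa> (ns j) * c j ^ ns j) / (\<Prod>j=1..h. fact (ns j))"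
      by (simp only: prod_dividef prod.distrib power_sum[symmetric] n)
    finally show "(\<Prod>j=1..h. (\<Prod>l=1..\<kappa>. mode_inv \<omega> (sin_fps (\<theta> j) 1) oo
        (fps_const (zeta_root \<kappa> ^ l * (x * c j)) * fps_X)) $ ns j) =
      x ^ n / fact n * (multinom h ns * (\<Prod>j=1..h. A_num_j \<omega> N j \<kappa> (ns j) * c j ^ ns j))"
      unfolding multinom_def n by simp
  qed
qed

lemma mult_sum_mod_ge3:
  assumes chi: "dirichlet_character N chi" and N: "N \<ge> 3" and \<kappa>: "\<kappa> \<ge> 1"
    and parity: "chi (-1) = (-1) ^ \<kappa>"
  shows "(\<lambda>M. mult_sum \<omega> (\<lambda>m. chi (int m) / of_nat m ^ \<kappa>) d M) \<longlonglongrightarrow>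
           of_real (C_num \<omega> N d \<kappa>) * A_num_ge3 \<omega> N \<kappa> chi (\<kappa> * d) * of_real pi ^ (\<kappa> * d)"
    and "\<not> \<kappa> dvd n \<Longrightarrow> A_num_ge3 \<omega> N \<kappa> chi n = 0"
proof -
  define a where "a = (\<lambda>m. chi (int m) / of_nat m ^ \<kappa>)"
  define h where "h = (N - 1) div 2"
  define c where "c = (\<lambda>j. princ_root \<kappa> (chi (int j)))"
  define \<theta> where "\<theta> = (\<lambda>j. complex_of_real (pi * real j / real N))"
  define r where "r = (\<lambda>j. of_nat j / of_nat N :: complex)"
  define s where "s = (\<Prod>j=1..h. sin (pi * real j / real N))"
  \<comment> \<open>With \<open>r j = j / N\<close> and scale \<open>- c j / N\<close>, the factors
    of the \<open>j\<close>-th block multiply out to \<open>1 - a m X^\<kappa>\<close> for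
    \<open>m\<close> congruent to \<open>j\<close> or \<open>- j\<close> modulo
    \<open>N\<close>.\<close>
  define G where "G = (\<Prod>j=1..h. \<Prod>l=1..\<kappa>. (fps_const (1 / sin (\<theta> j)) * sin_fps (\<theta> j) (of_real pi)) oo
      (fps_const (zeta_root \<kappa> ^ l * (- c j / of_nat N)) * fps_X))"
  have \<theta>_r: "of_real pi * r j = \<theta> j" for j by (simp add: \<theta>_def r_def)
  have sin_pos: "sin (pi * real j / real N) > 0" if "j \<in> {1..h}" for j
    using that N by (intro sin_gt_zero) (auto simp: h_def field_simps)
  have sin_\<theta>: "sin (\<theta> j) = of_real (sin (pi * real j / real N))" for j
    unfolding \<theta>_def by (simp only: sin_of_real)
  have nz: "sin (\<theta> j) \<noteq> 0" if "j \<in> {1..h}" for j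
    using sin_pos[OF that] unfolding sin_\<theta> by (simp only: of_real_eq_0_iff)
  have c_pow: "c j ^ \<kappa> = chi (int j)" for j
    unfolding c_def by (rule princ_root_power[OF \<kappa>])
  have chi_mult: "chi (x * y) = chi x * chi y" for x y
    using chi unfolding dirichlet_character_def by blast
  have a_plus: "(c j / (of_nat j + of_nat k * of_nat N)) ^ \<kappa> = a (k * N + j)" for j k
    using dirichlet_character_add_multiple[OF chi, of "int j" k]
    by (simp add: a_def power_divide c_pow add_ac)
  \<comment> \<open>Here the parity of the character enters: \<open>chi (-1) = (-1)^\<kappa>\<close>
    cancels the sign from \<open>j - k N = - (k N - j)\<close>.\<close>
  have a_minus: "(c j / (of_nat j - of_nat k * of_nat N)) ^ \<kappa> = a (k * N - j)" if "j \<in> {1..h}" "k \<ge> 1" for j k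
  proof -
    have "j \<le> 1 * N" using that by (auto simp: h_def)
    also have "\<dots> \<le> k * N" using that by (intro mult_right_mono) auto
    finally have le: "j \<le> k * N" .
    have "chi (int (k * N - j)) = (-1) ^ \<kappa> * chi (int j)"
      using le dirichlet_character_add_multiple[OF chi, of "(-1) * int j" k] chi_mult[of "-1" "int j"]
      by (simp add: of_nat_diff parity)
    moreover have "(of_nat (k * N - j) :: complex) = (-1) * (of_nat j - of_nat k * of_nat N)"
      using le by (simp add: of_nat_diff)
    ultimately show ?thesis
      by (simp only: a_def power_mult_distrib power_divide c_pow) simp
  qed
  have block: "(\<Prod>m=1..N * R + h. 1 - fps_const (a m) * fps_X ^ \<kappa>) = (\<Prod>j=1..h. \<Prod>l=1..\<kappa>.
      sin_block (r j) R oo (fps_const (zeta_root \<kappa> ^ l * (- c j / of_nat N)) * fps_X))" for R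
  proof -
    have "(\<Prod>m=1..N * R + h. 1 - fps_const (a m) * fps_X ^ \<kappa>) =
        (\<Prod>j=1..h. (1 - fps_const (a j) * fps_X ^ \<kappa>) * (\<Prod>k=1..R.
          (1 - fps_const (a (k * N - j)) * fps_X ^ \<kappa>) * (1 - fps_const (a (k * N + j)) * fps_X ^ \<kappa>)))"
      unfolding h_def
    proof (rule prod_symmetric_blocks[OF N])
      fix m assume "\<not> coprime m N"
      then have "chi (int m) = 0" using chi by (simp add: dirichlet_character_def)
      then show "1 - fps_const (a m) * fps_X ^ \<kappa> = 1" by (simp add: a_def)
    qed
    also have "\<dots> = (\<Prod>j=1..h. \<Prod>l=1..\<kappa>.
      sin_block (r j) R oo (fps_const (zeta_root \<kappa> ^ l * (- c j / of_nat N)) * fps_X))"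
    proof (rule prod.cong[OF refl])
      fix j assume j: "j \<in> {1..h}"
      have r1: "- (- c j / of_nat N) / r j = c j / of_nat j"
        using N by (simp add: r_def)
      have r2: "- (- c j / of_nat N) / (r j - of_nat k) = c j / (of_nat j - of_nat k * of_nat N)" for k
        using N by (simp add: r_def diff_divide_distrib[symmetric] field_simps)
      have r3: "- (- c j / of_nat N) / (r j + of_nat k) = c j / (of_nat j + of_nat k * of_nat N)" for k
        using N by (simp add: r_def add_divide_distrib[symmetric] field_simps)
      have a0: "(c j / of_nat j) ^ \<kappa> = a j" using a_plus[of j 0] by simp
      show "(1 - fps_const (a j) * fps_X ^ \<kappa>) * (\<Prod>k=1..R.
          (1 - fps_const (a (k * N - j)) * fps_X ^ \<kappa>) * (1 - fps_const (a (k * N + j)) * fps_X ^ \<kappa>)) =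
        (\<Prod>l=1..\<kappa>. sin_block (r j) R oo (fps_const (zeta_root \<kappa> ^ l * (- c j / of_nat N)) * fps_X))"
        unfolding prod_sin_block_compose[OF \<kappa>] r1 r2 r3 a0 a_plus
        by (intro arg_cong2[where f = "(*)"] refl prod.cong) (use a_minus[OF j] in auto)
    qed
    finally show ?thesis .
  qed
  have "fps_lim (sin_block (r j)) (fps_const (1 / sin (\<theta> j)) * sin_fps (\<theta> j) (of_real pi))" if "j \<in> {1..h}" for j
    using fps_lim_sin_block[of "r j"] nz[OF that] unfolding \<theta>_r by simp
  then have lim: "fps_lim (\<lambda>R. \<Prod>m=1..N * R + h. 1 - fps_const (a m) * fps_X ^ \<kappa>) G"
    unfolding block G_def by (intro fps_lim_prod fps_lim_compose_linear)
  define \<sigma> where "\<sigma> = (\<lambda>x::complex. case \<omega> of Bullet \<Rightarrow> 1 / x | Star \<Rightarrow> x)"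
  \<comment> \<open>The factor \<open>pi\<close> moves from the sine series into the scale, so that
    the series of \<open>T_num\<close> appears; the constants \<open>1 / sin\<close> are collected
    in \<open>\<sigma>\<close>.\<close>
  have factor: "mode_inv \<omega> ((fps_const (1 / sin (\<theta> j)) * sin_fps (\<theta> j) (of_real pi)) oo
      (fps_const (zeta_root \<kappa> ^ l * (- c j / of_nat N)) * fps_X)) =
    fps_const (\<sigma> (sin (\<theta> j))) * (mode_inv \<omega> (sin_fps (\<theta> j) 1) oo
      (fps_const (zeta_root \<kappa> ^ l * (- of_real pi / of_nat N * c j)) * fps_X))" if j: "j \<in> {1..h}" for j l
  proof -
    let ?z = "zeta_root \<kappa> ^ l * (- c j / of_nat N)"
    have "(fps_const (1 / sin (\<theta> j)) * sin_fps (\<theta> j) (of_real pi)) oo (fps_const ?z * fps_X) =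
        fps_const (1 / sin (\<theta> j)) * (sin_fps (\<theta> j) (of_real pi) oo (fps_const ?z * fps_X))"
      by (simp add: fps_compose_mult_distrib)
    also have "sin_fps (\<theta> j) (of_real pi) oo (fps_const ?z * fps_X) =
        sin_fps (\<theta> j) 1 oo (fps_const (of_real pi * ?z) * fps_X)"
      unfolding sin_fps_compose by (simp add: mult.commute)
    also have "of_real pi * ?z = zeta_root \<kappa> ^ l * (- of_real pi / of_nat N * c j)" by simp
    finally show ?thesis
      using nz[OF j]
      by (simp only: mode_inv_mult) (subst mode_inv_compose, auto simp: sin_fps_def mode_inv_def \<sigma>_def fps_const_inverse split: mode.split)
  qed
  have \<sigma>: "(\<Prod>j=1..h. \<Prod>l=1..\<kappa>. fps_const (\<sigma> (sin (\<theta> j)))) = fps_const (of_real ((case \<omega> of Bullet \<Rightarrow> 1 / s | Star \<Rightarrow> s) ^ \<kappa>))"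
  proof -
    have "(\<Prod>j=1..h. \<Prod>l=1..\<kappa>. fps_const (\<sigma> (sin (\<theta> j)))) = fps_const ((\<Prod>j\<in>{1..h}. \<sigma> (sin (\<theta> j))) ^ \<kappa>)"
      by (simp add: prod_fps_const prod_power_distrib)
    also have "(\<Prod>j\<in>{1..h}. \<sigma> (sin (\<theta> j))) = of_real (case \<omega> of Bullet \<Rightarrow> 1 / s | Star \<Rightarrow> s)"
      by (cases \<omega>) (simp_all add: \<sigma>_def s_def sin_\<theta> prod_dividef)
    finally show ?thesis by simp
  qed
  have "mode_inv \<omega> G = fps_const (of_real ((case \<omega> of Bullet \<Rightarrow> 1 / s | Star \<Rightarrow> s) ^ \<kappa>)) *
    (\<Prod>j=1..h. \<Prod>l=1..\<kappa>. mode_inv \<omega> (sin_fps (\<theta> j) 1) oo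
       (fps_const (zeta_root \<kappa> ^ l * (- of_real pi / of_nat N * c j)) * fps_X))"
    unfolding G_def mode_inv_prod \<sigma>[symmetric] prod.distrib[symmetric]
    by (intro prod.cong refl factor)
  then have nth: "mode_inv \<omega> G $ n = of_real ((case \<omega> of Bullet \<Rightarrow> 1 / s | Star \<Rightarrow> s) ^ \<kappa>) *
      ((- of_real pi / of_nat N) ^ n / fact n * A_num_ge3 \<omega> N \<kappa> chi n)" for n
    unfolding A_num_ge3_def h_def \<theta>_def c_def
    using N by (simp only: fps_mult_left_const_nth prod_A_num_j_nth)
  have a_lim: "a \<longlonglongrightarrow> 0"
    unfolding a_def by (rule dirichlet_character_over_power_tendsto_0[OF chi \<kappa>])
  have "(\<lambda>M. mult_sum \<omega> a d M) \<longlonglongrightarrow> of_int (eps \<omega>) ^ d * mode_inv \<omega> G $ (\<kappa> * d)"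
    by (rule mult_sum_tendsto[OF a_lim _ \<kappa> lim]) (use N in simp)
  also have "of_int (eps \<omega>) ^ d * mode_inv \<omega> G $ (\<kappa> * d) =
      of_real (C_num \<omega> N d \<kappa>) * A_num_ge3 \<omega> N \<kappa> chi (\<kappa> * d) * of_real pi ^ (\<kappa> * d)"
  proof -
    have "(- of_real pi / of_nat N :: complex) = of_real (-1 / real N) * of_real pi" by simp
    then have "(- of_real pi / of_nat N :: complex) ^ (\<kappa> * d) = of_real ((-1 / real N) ^ (\<kappa> * d)) * of_real pi ^ (\<kappa> * d)"
      by (simp only: power_mult_distrib of_real_power)
    moreover have "of_real (C_num \<omega> N d \<kappa>) = of_int (eps \<omega>) ^ d *
       (of_real ((case \<omega> of Bullet \<Rightarrow> 1 / s | Star \<Rightarrow> s) ^ \<kappa>) * of_real ((-1 / real N) ^ (\<kappa> * d)) / (fact (\<kappa> * d) :: complex))"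
      unfolding C_num_mod_ge3[OF N] s_def h_def
      by (simp only: of_real_mult of_real_divide of_real_power of_real_of_int_eq of_real_fact)
    ultimately show ?thesis unfolding nth by simp
  qed
  finally show "(\<lambda>M. mult_sum \<omega> (\<lambda>m. chi (int m) / of_nat m ^ \<kappa>) d M) \<longlonglongrightarrow>
           of_real (C_num \<omega> N d \<kappa>) * A_num_ge3 \<omega> N \<kappa> chi (\<kappa> * d) * of_real pi ^ (\<kappa> * d)"
    by (simp only: a_def)
  show "A_num_ge3 \<omega> N \<kappa> chi n = 0" if "\<not> \<kappa> dvd n"
  proof -
    have "mode_inv \<omega> G $ n = 0"
      by (rule mode_inv_nth_eq_0[OF a_lim _ \<kappa> lim that]) (use N in simp)
    moreover have "s > 0"
      unfolding s_def by (intro prod_pos sin_pos)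
    ultimately show ?thesis using N by (auto simp: nth split: mode.splits)
  qed
qed

text \<open>A \<open>lim\<close> carries no information for a divergent sequence, so convergence is
  asserted along with the value.\<close>

theorem theorem3p4:
  fixes N d \<kappa> e :: nat and k :: int and chi :: "int \<Rightarrow> complex" and \<omega> :: mode
  assumes "dirichlet_character N chi"
    and "e \<in> {0, 1}" and "chi (-1) = (-1) ^ e"
    and "int \<kappa> = 2 * k + int e" and "\<kappa> \<ge> 1"
    and "d \<ge> 1"
  shows "(\<forall>n. \<not> \<kappa> dvd n \<longrightarrow> A_num \<omega> N \<kappa> chi n = 0) \<and>
    convergent (mult_L_partial \<omega> (replicate d (of_nat \<kappa>)) (replicate d (\<lambda>m. chi (int m)))) \<and>
    mult_L \<omega> (replicate d (of_nat \<kappa>)) (replicate d (\<lambda>m. chi (int m)))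
      = of_real (C_num \<omega> N d \<kappa>) * A_num \<omega> N \<kappa> chi (\<kappa> * d) * of_real pi ^ (\<kappa> * d)"
proof -
  have N: "N \<ge> 1" and chi1: "chi 1 = 1" and per: "\<And>a. chi (a + int N) = chi a"
    and chi0: "\<And>a. chi a = 0 \<longleftrightarrow> \<not> coprime a (int N)"
    using assms(1) by (auto simp: dirichlet_character_def)
  define a where "a = (\<lambda>m. chi (int m) / of_nat m ^ \<kappa>)"
  have main: "(\<lambda>M. mult_sum \<omega> a d M) \<longlonglongrightarrow> of_real (C_num \<omega> N d \<kappa>) * A_num \<omega> N \<kappa> chi (\<kappa> * d) * of_real pi ^ (\<kappa> * d)
      \<and> (\<forall>n. \<not> \<kappa> dvd n \<longrightarrow> A_num \<omega> N \<kappa> chi n = 0)"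
  proof (cases "N \<ge> 3")
    case True
    have "even \<kappa> \<longleftrightarrow> even e" using arg_cong[OF assms(4), of even] by simp
    then have "chi (-1) = (-1) ^ \<kappa>" using assms(3) by (simp add: minus_one_power_iff)
    from mult_sum_mod_ge3[OF assms(1) True assms(5) this] True show ?thesis
      by (auto simp: A_num_def a_def)
  next
    case False
    have chi_odd: "chi (int m) = 1" if "N = 1 \<or> odd m" for m
    proof -
      have "N = 1 \<or> N = 2" using N False by linarith
      then have "m mod N = 1 mod N" using that by (auto simp: odd_iff_mod_2_eq_one)
      then show ?thesis
        using dirichlet_character_mod[OF assms(1), of m] dirichlet_character_mod[OF assms(1), of 1] chi1 by simp
    qed
    \<comment> \<open>Periodicity turns \<open>-1\<close> into the natural number
      \<open>N - 1\<close>, where \<open>chi\<close> is 1; so the character is even and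
      \<open>\<kappa> = 2 k\<close>.\<close>
    have "chi (-1 + int N) = chi (int (N - 1))" using N by (simp add: of_nat_diff)
    moreover have "N = 1 \<or> odd (N - 1)" using N False by presburger
    ultimately have "chi (-1) = 1" using per[of "-1"] chi_odd[of "N - 1"] by simp
    then have "e = 0" using assms(2,3) by auto
    then have \<kappa>: "\<kappa> = 2 * nat k" using assms(4) by linarith
    then have k: "nat k \<ge> 1" using assms(5) by simp
    \<comment> \<open>For \<open>N \<le> 2\<close>, \<open>A_num\<close> is 0 at odd indices and
      halves even ones, so divisibility has to be transferred only for even
      \<open>n\<close>.\<close>
    have dvd: "\<not> nat k dvd n div 2" if "\<not> \<kappa> dvd n" "even n" for n
      using that by (auto simp: \<kappa> elim!: evenE)
    have half: "2 * nat k * d div 2 = nat k * d" by simp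
    consider "N = 1" | "N = 2" using N False by linarith
    then show ?thesis
    proof cases
      case 1
      have "a = (\<lambda>m. 1 / of_nat m ^ (2 * nat k))"
        using 1 by (simp add: a_def chi_odd \<kappa>)
      then show ?thesis
        using mult_sum_mod_1[OF k, where \<omega> = \<omega>] dvd by (simp add: A_num_def 1 \<kappa> half)
    next
      case 2
      have "chi (int m) = (if even m then 0 else 1)" for m
        using chi_odd[of m] chi0[of "int m"] 2 by (auto simp: coprime_iff_gcd_eq_1)
      then have "a = (\<lambda>m. (if even m then 0 else 1) / of_nat m ^ (2 * nat k))"
        by (simp add: a_def \<kappa>)
      then show ?thesis
        using mult_sum_mod_2[OF k, where \<omega> = \<omega>] dvd by (simp add: A_num_def 2 \<kappa> half)
    qed
  qed
  have "mult_L_partial \<omega> (replicate d (of_nat \<kappa>)) (replicate d (\<lambda>m. chi (int m))) = (\<lambda>M. mult_sum \<omega> a d M)"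
    by (simp add: fun_eq_iff mult_L_partial_replicate a_def)
  with main show ?thesis
    by (auto simp: mult_L_def convergent_def intro: limI)
qed

end
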